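(* Let $A=(a_{ij})\in \mathbf{RM}_n$, $m=\lfloor n/2\rfloor$, and $\xi_j=(|a_{j,j+1}|-|a_{j+1,j}|)^2/4$ for $j=1,\dots,n-1$. Then for $C(A)$ to contain an ellipse $E$ centered at the origin the following conditions are necessary and sufficient: (i) the foci of $E$ are located at $\pm X$ for $X=2\cos\frac{k\pi}{n+1}$ and some $k=1,\dots,m$; (ii) the variables $\xi_1,\dots,\xi_{n-1}$ satisfy the system of $m-1$ homogeneous polynomial equations (of degrees ranging from $2$ to $m$) obtained as follows. With $P_n$ as defined in the context, write $$P_n(C+\rho X^2)=\sum_{j=0}^{m} f_j(\xi,C,X)\,\rho^j .$$ For $X$ as in (i) the equation $f_m(\xi,C,X)=0$ is satisfied, while the equation $f_{m-1}(\xi,C,X)=0$, which is linear in $C,\xi_1,\dots,\xi_{n-1}$ with a non-zero coefficient of $C$, expresses $C$ uniquely as a linear combination of $\xi_1,\dots,\xi_{n-1}$. Plugging this expression for $C$ into the equations $f_j(\xi,C,X)=0$, $j=0,1,\dots,m-2$, yields the system.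
   Context: $\mathbf{RM}_n$ is the set of complex $n\times n$ tridiagonal matrices $A=(a_{ij})$ with zero main diagonal and $a_{i,i+1}a_{i+1,i}=1$ for $i=1,\dots,n-1$ (reciprocal matrices). For a square matrix $A$, $\operatorname{Re}A=(A+A^* )/2$; the Kippenhahn polynomial of $A$ is $P_A(\lambda,\theta)=\det(\operatorname{Re}(e^{i\theta}A)-\lambda I)$, and the Kippenhahn curve $C(A)$ is the envelope of the family of lines $\{e^{-i\theta}(\lambda_j(\theta)+i\mathbb R):\theta\in(-\pi,\pi],\ j=1,\dots,n\}$, where $\lambda_j(\theta)$ are the roots of $P_A(\cdot,\theta)$. Put $\rho=\cos^2\theta$, $\zeta=\lambda^2$, and write $i\prec j$ if $i,j\in\mathbb N$ and $j-i>1$. For $A\in\mathbf{RM}_n$ one has $P_A(\lambda,\theta)=P_n(\lambda^2)$ if $n$ is even and $P_A(\lambda,\theta)=-\lambda P_n(\lambda^2)$ if $n$ is odd, where $P_n(\zeta)=\zeta^m+\sum_{j=0}^{m-1}p_j\zeta^j$ with $p_{m-j}=(-1)^j\sum_{1\le i_1\prec i_2\prec\cdots\prec i_j<n}\prod_{k=1}^j(\xi_{i_k}+\rho)$, $j=1,\dots,m$. In the construction, $C$ stands for the square of the length of the minor half-axis of $E$. *)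

theory Defs
  imports Complex_Main "Jordan_Normal_Form.Schur_Decomposition"
begin

(* Matrix indices start at 0: the entry a_{i,j} of the mathematical text is A $$ (i - 1, j - 1). *)

definition reciprocal_matrices :: "nat \<Rightarrow> complex mat set" where
  "reciprocal_matrices n =
     {A \<in> carrier_mat n n.
        (\<forall>i<n. \<forall>j<n. j \<noteq> Suc i \<and> i \<noteq> Suc j \<longrightarrow> A $$ (i, j) = 0) \<and>
        (\<forall>i. Suc i < n \<longrightarrow> A $$ (i, Suc i) * A $$ (Suc i, i) = 1)}"

definition Re_mat :: "complex mat \<Rightarrow> complex mat" where
  "Re_mat A = (1 / 2) \<cdot>\<^sub>m (A + mat_adjoint A)"

definition kippenhahn_poly :: "complex mat \<Rightarrow> complex \<Rightarrow> real \<Rightarrow> complex" where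
  "kippenhahn_poly A l \<theta> = det (Re_mat (cis \<theta> \<cdot>\<^sub>m A) - l \<cdot>\<^sub>m 1\<^sub>m (dim_row A))"

definition support_line :: "real \<Rightarrow> real \<Rightarrow> complex set" where
  "support_line \<theta> l = {cis (- \<theta>) * (complex_of_real l + \<i> * complex_of_real t) | t. True}"

(* Only real l are needed: Re_mat (cis \<theta> \<cdot>\<^sub>m A) is Hermitian, so all its eigenvalues are real. *)
definition kippenhahn_lines :: "complex mat \<Rightarrow> complex set set" where
  "kippenhahn_lines A =
     {support_line \<theta> l | \<theta> l. \<theta> \<in> {- pi<..pi} \<and> kippenhahn_poly A (complex_of_real l) \<theta> = 0}"

(* The envelope of the lines support_line \<theta> (l \<theta>), where l is a local branch of the
   eigenvalues. The line with parameter \<theta> has the equation F(z, \<theta>) = 0 with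
   F(z, \<theta>) = Re (cis \<theta> * z) - l \<theta>, and z is a point of the envelope iff both F and its partial
   derivative in \<theta> vanish at z. At a crossing of eigenvalues this gives the same points as the
   analytic branches: a branch l that is merely differentiable at \<theta> agrees with one of the
   finitely many analytic branches along a sequence converging to \<theta>, and so has the same value
   and derivative at \<theta>. *)
definition kippenhahn_curve :: "complex mat \<Rightarrow> complex set" where
  "kippenhahn_curve A =
     {z. \<exists>\<theta>\<in>{- pi<..pi}. \<exists>l :: real \<Rightarrow> real.
        (\<forall>\<^sub>F t in nhds \<theta>. kippenhahn_poly A (complex_of_real (l t)) t = 0) \<and>
        z \<in> support_line \<theta> (l \<theta>) \<and>
        ((\<lambda>t. Re (cis t * z) - l t) has_real_derivative 0) (at \<theta>)}"

(* Foci F and -F, minor half-axis b, hence major half-axis sqrt ((cmod F)\<^sup>2 + b\<^sup>2).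
   For b > 0 these are exactly the (non-degenerate) ellipses centered at 0. *)
definition centered_ellipse :: "complex \<Rightarrow> real \<Rightarrow> complex set" where
  "centered_ellipse F b = {z. cmod (z - F) + cmod (z + F) = 2 * sqrt ((cmod F)\<^sup>2 + b\<^sup>2)}"

(* The degenerate ellipse with foci F, -F and minor half-axis 0, regarded as an envelope, is the
   pair {F, -F} enveloped by the two pencils of lines through F and through -F. It is part of
   the Kippenhahn curve iff these pencils are part of the family; mere membership of the
   points F and -F in the curve would not express this. *)
definition contains_degenerate_ellipse :: "complex mat \<Rightarrow> complex \<Rightarrow> bool" where
  "contains_degenerate_ellipse A F \<longleftrightarrow>
     (\<forall>\<theta>\<in>{- pi<..pi}. support_line \<theta> (Re (cis \<theta> * F)) \<in> kippenhahn_lines A \<and>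
                     support_line \<theta> (Re (cis \<theta> * (- F))) \<in> kippenhahn_lines A)"

(* Here j = 1, ..., n - 1. *)
definition recip_xi :: "complex mat \<Rightarrow> nat \<Rightarrow> real" where
  "recip_xi A j = (cmod (A $$ (j - 1, j)) - cmod (A $$ (j, j - 1)))\<^sup>2 / 4"

(* A chain i_1 \<prec> ... \<prec> i_j in {1, ..., n - 1} is represented by its set of members. *)
definition sparse_chains :: "nat \<Rightarrow> nat \<Rightarrow> nat set set" where
  "sparse_chains n j = {S. S \<subseteq> {1..<n} \<and> card S = j \<and> (\<forall>a\<in>S. \<forall>b\<in>S. a < b \<longrightarrow> b - a > 1)}"

(* The ring is left open so that the value can be expanded as a polynomial in \<rho>;
   the summand j = 0 is the leading term \<zeta> ^ m with m = n div 2. *)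
definition recip_P :: "nat \<Rightarrow> (nat \<Rightarrow> 'a) \<Rightarrow> 'a \<Rightarrow> 'a \<Rightarrow> 'a :: comm_ring_1" where
  "recip_P n \<xi> \<rho> \<zeta> =
     (\<Sum>j = 0..n div 2. (- 1) ^ j * (\<Sum>S\<in>sparse_chains n j. \<Prod>i\<in>S. (\<xi> i + \<rho>)) * \<zeta> ^ (n div 2 - j))"

(* The coefficient of \<rho> ^ j in P_n (C + \<rho> X\<^sup>2); the indeterminate [:0, 1:] stands for \<rho>. *)
definition recip_f :: "nat \<Rightarrow> nat \<Rightarrow> (nat \<Rightarrow> real) \<Rightarrow> real \<Rightarrow> real \<Rightarrow> real" where
  "recip_f n j \<xi> C X = coeff (recip_P n (\<lambda>i. [:\<xi> i:]) [:0, 1:] [:C, X\<^sup>2:]) j"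

definition minor_sq :: "nat \<Rightarrow> (nat \<Rightarrow> real) \<Rightarrow> real \<Rightarrow> real" where
  "minor_sq n \<xi> X = (THE C. recip_f n (n div 2 - 1) \<xi> C X = 0)"

(* j < m - 1 means j = 0, ..., m - 2, also when m = 1. *)
definition recip_system :: "nat \<Rightarrow> (nat \<Rightarrow> real) \<Rightarrow> real \<Rightarrow> bool" where
  "recip_system n \<xi> X \<longleftrightarrow> (\<forall>j < n div 2 - 1. recip_f n j \<xi> (minor_sq n \<xi> X) X = 0)"

(* g is a real homogeneous polynomial of degree d in the variables x i, i \<in> I (I finite). *)
definition homogeneous_polynomial :: "nat set \<Rightarrow> nat \<Rightarrow> ((nat \<Rightarrow> real) \<Rightarrow> real) \<Rightarrow> bool" where
  "homogeneous_polynomial I d g \<longleftrightarrow>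
     (\<exists>c :: (nat \<Rightarrow> nat) \<Rightarrow> real. \<forall>x.
        g x = (\<Sum>\<alpha> | (\<forall>i. i \<notin> I \<longrightarrow> \<alpha> i = 0) \<and> sum \<alpha> I = d. c \<alpha> * (\<Prod>i\<in>I. x i ^ \<alpha> i)))"

end

theory Submission
  imports "HOL-Analysis.Lebesgue_Measure" Defs
begin

text \<open>
  Expanding the determinant of the tridiagonal matrix gives
  \<open>P\<^sub>A(\<lambda>, \<theta>) = \<plusminus> \<lambda>\<^bsup>n mod 2\<^esup> P\<^sub>n(\<lambda>\<^sup>2)\<close>, and for \<open>\<xi> = 0\<close> this is a Chebyshev polynomial, whose squared
  roots are the \<open>X\<^sup>2\<close> of condition (i).  They are simple, which makes the coefficient of \<open>C\<close> in
  \<open>f\<^bsub>m-1\<^esub>\<close> non-zero.  If the system holds, then \<open>P\<^sub>n(C + \<rho> X\<^sup>2)\<close> vanishes identically, so every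
  tangent of the ellipse belongs to the family of lines.

  For the converse no analytic parametrization of the eigenvalues is needed.  A line of the family
  whose point of contact with the envelope lies on the ellipse, but which crosses the ellipse
  transversally there, meets the ellipse at a point that is stationary to first order in \<open>\<theta>\<close>.  As
  every \<open>\<theta>\<close> admits boundedly many crossings, a Sard-type covering argument shows that such stationary
  points form a null set.  So infinitely many lines of the family are tangent to the ellipse, and a
  trigonometric polynomial vanishes identically; its leading coefficient identifies the foci.
\<close>

section \<open>The polynomials \<open>P\<^sub>n\<close>\<close>

text \<open>Membership in \<open>kippenhahn_curve\<close> is pointwise: each point of the ellipse
  brings its own \<theta> and its own branch l, chosen without any regularity, and l need only be
  differentiable at that \<theta>. A priori the ellipse could be covered by contact points of
  branches that cross it; the measure argument rules this out. Half-angle coordinates turn incidence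
  with a line into a quadratic equation, which bounds the number of crossings and reduces their
  first-order motion to that of a simple root. P_n is homogeneous of degree m in \<xi>, \<rho> and
  \<zeta> jointly. This gives the degrees in the system, the independence of f_m from \<xi> and C,
  and the clearing of denominators in the trigonometric polynomial. Reality of the foci falls out,
  since F^2 is a root of a polynomial of degree m with m known distinct real roots. The sign of C is
  decided at \<rho> = 0, where P_n has no negative root because \<xi> \<ge> 0.\<close>

lemma finite_sparse_chains [simp]: "finite (sparse_chains n j)"
  by (rule finite_subset[of _ "Pow {1..<n}"]) (auto simp: sparse_chains_def)

lemma sparse_chains_finite: "S \<in> sparse_chains n j \<Longrightarrow> finite S"
  by (auto simp: sparse_chains_def intro: finite_subset)

lemma sparse_chains_0 [simp]: "sparse_chains n 0 = {{}}"
proof -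
  have "S = {}" if "S \<in> sparse_chains n 0" for S
    using that sparse_chains_finite[OF that] by (simp add: sparse_chains_def)
  then show ?thesis by (auto simp: sparse_chains_def)
qed

text \<open>Split by the largest admissible index: a chain containing \<open>Suc n\<close> cannot
  contain \<open>n\<close>, so its other members lie in \<open>{1..<n}\<close>.\<close>

lemma sparse_chains_Suc_Suc:
  "sparse_chains (Suc (Suc n)) (Suc j) =
     sparse_chains (Suc n) (Suc j) \<union> insert (Suc n) ` sparse_chains n j"
proof (intro equalityI subsetI)
  fix S assume S: "S \<in> sparse_chains (Suc (Suc n)) (Suc j)"
  have fin: "finite S" using S by (rule sparse_chains_finite)
  show "S \<in> sparse_chains (Suc n) (Suc j) \<union> insert (Suc n) ` sparse_chains n j"
  proof (cases "Suc n \<in> S")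
    case False
    have "S \<subseteq> {1..<Suc n}"
    proof
      fix a assume "a \<in> S"
      then have "a \<in> {1..<Suc (Suc n)}" "a \<noteq> Suc n" using S False by (auto simp: sparse_chains_def)
      then show "a \<in> {1..<Suc n}" by simp
    qed
    then show ?thesis using S by (simp add: sparse_chains_def)
  next
    case True
    have "a < n" if "a \<in> S" "a \<noteq> Suc n" for a
    proof -
      have "a \<in> {1..<Suc (Suc n)}" using that S by (auto simp: sparse_chains_def)
      then have "a < Suc n" using that by simp
      then have "Suc n - a > 1" using that S True by (auto simp: sparse_chains_def)
      then show ?thesis by simp
    qed
    then have "S - {Suc n} \<in> sparse_chains n j"
      using S True fin by (fastforce simp: sparse_chains_def)
    moreover have "S = insert (Suc n) (S - {Suc n})" using True by auto
    ultimately show ?thesis by blast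
  qed
next
  fix S assume "S \<in> sparse_chains (Suc n) (Suc j) \<union> insert (Suc n) ` sparse_chains n j"
  then show "S \<in> sparse_chains (Suc (Suc n)) (Suc j)"
  proof
    assume "S \<in> sparse_chains (Suc n) (Suc j)"
    then show ?thesis by (auto simp: sparse_chains_def)
  next
    assume "S \<in> insert (Suc n) ` sparse_chains n j"
    then obtain T where T: "T \<in> sparse_chains n j" and S: "S = insert (Suc n) T" by blast
    have "finite T" using T by (rule sparse_chains_finite)
    moreover have "T \<subseteq> {1..<n}" "card T = j" using T by (auto simp: sparse_chains_def)
    moreover from this have "Suc n \<notin> T" "\<And>a. a \<in> T \<Longrightarrow> Suc n - a > 1" "\<And>a. a \<in> T \<Longrightarrow> a < Suc n" by fastforce+
    ultimately show ?thesis using T unfolding S sparse_chains_def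
      by (auto simp: card_insert_if dest: less_asym)
  qed
qed

text \<open>Members are at least 2 apart, so j of them need 2 j - 1 of the n - 1 places.\<close>

lemma sparse_chains_empty: "n < 2 * j \<Longrightarrow> sparse_chains n j = {}"
proof (induction n arbitrary: j rule: induct_nat_012)
  case 0
  then show ?case by (auto simp: sparse_chains_def)
next
  case 1
  then show ?case by (auto simp: sparse_chains_def)
next
  case (ge2 n)
  then obtain i where "j = Suc i" by (cases j) auto
  then show ?case using ge2 by (simp add: sparse_chains_Suc_Suc)
qed

text \<open>Sparse sets are the matchings of the path on n vertices, edge i joining i and i + 1;
  \<open>y\<close> gives the edge weights.\<close>

definition chain_sum :: "nat \<Rightarrow> (nat \<Rightarrow> 'a) \<Rightarrow> nat \<Rightarrow> 'a :: comm_ring_1" where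
  "chain_sum n y j = (\<Sum>S\<in>sparse_chains n j. \<Prod>i\<in>S. y i)"

lemma recip_P_chain_sum:
  "recip_P n \<xi> \<rho> \<zeta> =
     (\<Sum>j\<le>n div 2. (- 1) ^ j * chain_sum n (\<lambda>i. \<xi> i + \<rho>) j * \<zeta> ^ (n div 2 - j))"
  by (simp add: recip_P_def chain_sum_def atMost_atLeast0)

lemma chain_sum_0 [simp]: "chain_sum n y 0 = 1"
  by (simp add: chain_sum_def)

lemma chain_sum_eq_0: "n < 2 * j \<Longrightarrow> chain_sum n y j = 0"
  by (simp add: chain_sum_def sparse_chains_empty)

lemma chain_sum_Suc_Suc:
  "chain_sum (Suc (Suc n)) y (Suc j) = chain_sum (Suc n) y (Suc j) + y (Suc n) * chain_sum n y j"
proof -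
  have notin: "Suc n \<notin> S" if "S \<in> sparse_chains n j" for S
    using that by (auto simp: sparse_chains_def)
  have disj: "sparse_chains (Suc n) (Suc j) \<inter> insert (Suc n) ` sparse_chains n j = {}"
    by (auto simp: sparse_chains_def)
  have inj: "inj_on (insert (Suc n)) (sparse_chains n j)"
    using notin by (intro inj_onI) (metis Diff_insert_absorb)
  have "(\<Sum>S\<in>insert (Suc n) ` sparse_chains n j. prod y S) =
        (\<Sum>S\<in>sparse_chains n j. y (Suc n) * prod y S)"
    using notin by (simp add: sum.reindex[OF inj] sparse_chains_finite)
  then show ?thesis
    unfolding chain_sum_def sparse_chains_Suc_Suc
    by (subst sum.union_disjoint[OF _ _ disj]) (simp_all add: sum_distrib_left)
qed

text \<open>The weighted matching polynomial of the path. The sum runs to n instead of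
  \<open>n div 2\<close> so that the recursion needs no parity cases; for 2 j > n the exponent is
  truncated, but the chain sum is 0.\<close>

definition recip_K :: "nat \<Rightarrow> (nat \<Rightarrow> 'a) \<Rightarrow> 'a \<Rightarrow> 'a :: comm_ring_1" where
  "recip_K n y l = (\<Sum>j\<le>n. (- 1) ^ j * chain_sum n y j * l ^ (n - 2 * j))"

lemma recip_K_eq_P: "recip_K n (\<lambda>i. \<xi> i + \<rho>) l = l ^ (n mod 2) * recip_P n \<xi> \<rho> (l\<^sup>2)"
proof -
  have "recip_K n (\<lambda>i. \<xi> i + \<rho>) l =
      (\<Sum>j\<le>n div 2. (- 1) ^ j * chain_sum n (\<lambda>i. \<xi> i + \<rho>) j * l ^ (n - 2 * j))"
    unfolding recip_K_def
  proof (rule sum.mono_neutral_right)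
    have "chain_sum n (\<lambda>i. \<xi> i + \<rho>) j = 0" if "\<not> j \<le> n div 2" for j
      using that by (intro chain_sum_eq_0) simp
    then show "\<forall>j\<in>{..n} - {..n div 2}. (- 1) ^ j * chain_sum n (\<lambda>i. \<xi> i + \<rho>) j * l ^ (n - 2 * j) = 0"
      by simp
  qed auto
  also have "\<dots> = (\<Sum>j\<le>n div 2. (- 1) ^ j * chain_sum n (\<lambda>i. \<xi> i + \<rho>) j *
                      (l ^ (n mod 2) * (l\<^sup>2) ^ (n div 2 - j)))"
  proof (rule sum.cong[OF refl])
    fix j assume "j \<in> {..n div 2}"
    then have "n - 2 * j = n mod 2 + 2 * (n div 2 - j)"
      by (simp only: atMost_iff) presburger
    then show "(- 1) ^ j * chain_sum n (\<lambda>i. \<xi> i + \<rho>) j * l ^ (n - 2 * j) =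
      (- 1) ^ j * chain_sum n (\<lambda>i. \<xi> i + \<rho>) j * (l ^ (n mod 2) * (l\<^sup>2) ^ (n div 2 - j))"
      by (simp add: power_add power_mult)
  qed
  finally show ?thesis
    by (simp add: recip_P_chain_sum sum_distrib_left algebra_simps)
qed

lemma recip_K_0 [simp]: "recip_K 0 y l = 1"
  and recip_K_1 [simp]: "recip_K (Suc 0) y l = l"
  by (simp_all add: recip_K_def chain_sum_eq_0)

text \<open>The recurrence of continuants: a matching either avoids the last edge or uses it. It
  mirrors the expansion of a tridiagonal determinant along its last row.\<close>

lemma recip_K_Suc_Suc:
  "recip_K (Suc (Suc n)) y l = l * recip_K (Suc n) y l - y (Suc n) * recip_K n y l"
proof -
  have "recip_K (Suc (Suc n)) y l =
      l ^ (n + 2) - (\<Sum>j\<le>Suc n. (- 1) ^ j * chain_sum (Suc n) y (Suc j) * l ^ (n - 2 * j)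
                        + y (Suc n) * ((- 1) ^ j * chain_sum n y j * l ^ (n - 2 * j)))"
    unfolding recip_K_def
    by (subst sum.atMost_Suc_shift)
       (simp add: chain_sum_Suc_Suc algebra_simps sum.distrib sum_negf sum_subtractf)
  also have "\<dots> = l ^ (n + 2) - (\<Sum>j\<le>Suc n. (- 1) ^ j * chain_sum (Suc n) y (Suc j) * l ^ (n - 2 * j))
                   - y (Suc n) * (\<Sum>j\<le>Suc n. (- 1) ^ j * chain_sum n y j * l ^ (n - 2 * j))"
    by (simp only: sum.distrib sum_distrib_left diff_diff_eq)
  also have "(\<Sum>j\<le>Suc n. (- 1) ^ j * chain_sum n y j * l ^ (n - 2 * j)) = recip_K n y l"
    by (simp add: recip_K_def chain_sum_eq_0)
  also have "l ^ (n + 2) - (\<Sum>j\<le>Suc n. (- 1) ^ j * chain_sum (Suc n) y (Suc j) * l ^ (n - 2 * j))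
              = l * recip_K (Suc n) y l"
  proof -
    \<comment> \<open>Where truncated subtraction breaks the identity of exponents, the chain sum
      vanishes.\<close>
    have *: "chain_sum (Suc n) y (Suc j) * l ^ (n - 2 * j) =
             l * (chain_sum (Suc n) y (Suc j) * l ^ (Suc n - 2 * Suc j))" for j
    proof (cases "Suc n < 2 * Suc j")
      case False
      then have "n - 2 * j = Suc (Suc n - 2 * Suc j)" by simp
      then show ?thesis by simp
    qed (simp add: chain_sum_eq_0)
    have "l * recip_K (Suc n) y l =
        l * (\<Sum>j\<le>Suc (Suc n). (- 1) ^ j * chain_sum (Suc n) y j * l ^ (Suc n - 2 * j))"
      by (simp add: recip_K_def chain_sum_eq_0)
    also have "\<dots> = l ^ (n + 2) - (\<Sum>j\<le>Suc n. (- 1) ^ j *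
                       (l * (chain_sum (Suc n) y (Suc j) * l ^ (Suc n - 2 * Suc j))))"
      by (subst sum.atMost_Suc_shift)
         (simp del: sum.atMost_Suc add: sum_negf sum_distrib_left algebra_simps)
    finally show ?thesis unfolding *[symmetric] by (simp add: mult.assoc)
  qed
  finally show ?thesis .
qed

text \<open>For unit weights the recurrence is that of the Chebyshev polynomials U_n(x/2) at x = 2
  cos t; the factor \<open>sin t\<close> avoids a division.\<close>

lemma recip_K_Chebyshev:
  fixes t :: real
  shows "recip_K n (\<lambda>_. 1) (2 * cos t) * sin t = sin (real (Suc n) * t)"
proof (induction n rule: induct_nat_012)
  case 1
  then show ?case using sin_double[of t] by (simp add: mult.commute mult.left_commute)
next
  case (ge2 n)
  have "sin (real (Suc (Suc (Suc n))) * t) + sin (real (Suc n) * t)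
      = 2 * sin (real (Suc (Suc n)) * t) * cos t"
  proof -
    have "real (Suc (Suc (Suc n))) * t = real (Suc (Suc n)) * t + t"
         "real (Suc n) * t = real (Suc (Suc n)) * t - t" by (simp_all add: algebra_simps)
    then show ?thesis by (simp only: sin_add sin_diff)
  qed
  moreover have "2 * c * w - v = u" if "u + v = 2 * w * c" for u v w c :: real
    using that by (simp add: algebra_simps)
  ultimately have "2 * cos t * sin (real (Suc (Suc n)) * t) - sin (real (Suc n) * t)
      = sin (real (Suc (Suc (Suc n))) * t)" by blast
  then show ?case using ge2 by (simp add: recip_K_Suc_Suc left_diff_distrib mult.assoc)
qed simp

section \<open>Coefficients of highest formal degree, and homogeneity of P_n\<close>

lemma coeff_mult_top:
  fixes p q :: "'a :: comm_ring_1 poly"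
  assumes "degree p \<le> a" "degree q \<le> b"
  shows "coeff (p * q) (a + b) = coeff p a * coeff q b"
proof -
  have "coeff (p * q) (a + b) = (\<Sum>i\<le>a + b. coeff p i * coeff q (a + b - i))"
    by (rule coeff_mult)
  also have "\<dots> = (\<Sum>i\<in>{a}. coeff p i * coeff q (a + b - i))"
  proof (rule sum.mono_neutral_right)
    show "\<forall>i\<in>{..a + b} - {a}. coeff p i * coeff q (a + b - i) = 0"
    proof
      fix i assume i: "i \<in> {..a + b} - {a}"
      show "coeff p i * coeff q (a + b - i) = 0"
      proof (cases "i < a")
        case True
        then have "degree q < a + b - i" using assms by simp
        then show ?thesis by (simp add: coeff_eq_0)
      next
        case False
        then have "degree p < i" using assms i by simp
        then show ?thesis by (simp add: coeff_eq_0)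
      qed
    qed
  qed auto
  finally show ?thesis by simp
qed

lemma coeff_prod_top:
  fixes p :: "'b \<Rightarrow> 'a :: comm_ring_1 poly"
  assumes "finite S" "\<And>i. i \<in> S \<Longrightarrow> degree (p i) \<le> d"
  shows "degree (prod p S) \<le> d * card S \<and> coeff (prod p S) (d * card S) = (\<Prod>i\<in>S. coeff (p i) d)"
  using assms
proof (induction S rule: finite_induct)
  case (insert x F)
  then have "degree (p x * prod p F) \<le> d + d * card F"
    by (intro order.trans[OF degree_mult_le] add_mono) auto
  moreover have "coeff (p x * prod p F) (d + d * card F) = coeff (p x) d * (\<Prod>i\<in>F. coeff (p i) d)"
    using insert by (subst coeff_mult_top) auto
  ultimately show ?case using insert by simp
qed simp

lemma coeff_power_top:
  fixes p :: "'a :: comm_ring_1 poly"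
  assumes "degree p \<le> d"
  shows "degree (p ^ r) \<le> d * r \<and> coeff (p ^ r) (d * r) = coeff p d ^ r"
  using coeff_prod_top[of "{..<r}" "\<lambda>_. p" d] assms by simp

text \<open>Each summand is built from products of m factors of degree at most \<open>d\<close>, so
  only their coefficients at \<open>d\<close> contribute. The case \<open>d = 1\<close> yields f_m
  and monicity in \<zeta>; \<open>d = 4\<close> serves the trigonometric polynomial.\<close>

lemma coeff_recip_P_top:
  fixes \<Xi> :: "nat \<Rightarrow> 'a :: comm_ring_1 poly"
  assumes "\<And>i. degree (\<Xi> i) \<le> d" "degree R \<le> d" "degree Z \<le> d"
  shows "degree (recip_P n \<Xi> R Z) \<le> d * (n div 2)"
    and "coeff (recip_P n \<Xi> R Z) (d * (n div 2)) =
           recip_P n (\<lambda>i. coeff (\<Xi> i) d) (coeff R d) (coeff Z d)"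
proof -
  let ?m = "n div 2"
  let ?y = "\<lambda>i. \<Xi> i + R" and ?c = "\<lambda>i. coeff (\<Xi> i) d + coeff R d"
  have prod: "degree (prod ?y S) \<le> d * j \<and> coeff (prod ?y S) (d * j) = prod ?c S"
    if "S \<in> sparse_chains n j" for S j
    using coeff_prod_top[of S ?y d] that sparse_chains_finite[OF that] assms
    by (auto simp: sparse_chains_def degree_add_le)
  have chain: "degree (chain_sum n ?y j) \<le> d * j" "coeff (chain_sum n ?y j) (d * j) = chain_sum n ?c j" for j
    using prod by (auto simp: chain_sum_def coeff_sum intro!: degree_sum_le)
  have pw: "degree (Z ^ r) \<le> d * r \<and> coeff (Z ^ r) (d * r) = coeff Z d ^ r" for r
    by (rule coeff_power_top) fact
  have sgn: "(- 1) ^ j * p = smult ((- 1) ^ j) p" for j and p :: "'a poly"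
    by (cases "even j") auto
  have "degree (chain_sum n ?y j * Z ^ (?m - j)) \<le> d * ?m \<and>
        coeff (chain_sum n ?y j * Z ^ (?m - j)) (d * ?m) = chain_sum n ?c j * coeff Z d ^ (?m - j)"
    if "j \<le> ?m" for j
  proof -
    have e: "d * ?m = d * j + d * (?m - j)" using that by (simp flip: distrib_left)
    show ?thesis unfolding e
      using chain pw[of "?m - j"] by (subst coeff_mult_top) (auto intro!: degree_mult_le[THEN order.trans] add_mono)
  qed
  note t = this
  show "degree (recip_P n \<Xi> R Z) \<le> d * ?m"
    unfolding recip_P_chain_sum mult.assoc sgn
    using t by (intro degree_sum_le) (auto intro!: degree_smult_le[THEN order.trans])
  show "coeff (recip_P n \<Xi> R Z) (d * ?m) = recip_P n (\<lambda>i. coeff (\<Xi> i) d) (coeff R d) (coeff Z d)"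
    unfolding recip_P_chain_sum mult.assoc sgn coeff_sum coeff_smult
    using t by (intro sum.cong) auto
qed

lemma poly_recip_P:
  "poly (recip_P n \<Xi> R Z) x = recip_P n (\<lambda>i. poly (\<Xi> i) x) (poly R x) (poly Z x)"
  by (simp add: recip_P_def poly_sum poly_prod)

lemma of_real_recip_P:
  "(of_real (recip_P n \<xi> \<rho> \<zeta>) :: 'a :: {real_algebra_1,comm_ring_1}) =
     recip_P n (\<lambda>i. of_real (\<xi> i)) (of_real \<rho>) (of_real \<zeta>)"
  by (simp add: recip_P_def)

text \<open>Used with \<open>c = - 1\<close> for signs at negative \<zeta>, and with c = 4 (cis
  \<theta>)^2 to clear negative powers of cis \<theta>.\<close>

lemma recip_P_scale:
  "recip_P n (\<lambda>i. c * \<xi> i) (c * \<rho>) (c * \<zeta>) = c ^ (n div 2) * recip_P n \<xi> \<rho> \<zeta>"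
proof -
  have "chain_sum n (\<lambda>i. c * \<xi> i + c * \<rho>) j = c ^ j * chain_sum n (\<lambda>i. \<xi> i + \<rho>) j" for j
    unfolding chain_sum_def sum_distrib_left
    by (rule sum.cong) (auto simp: sparse_chains_def prod.distrib simp flip: distrib_left)
  moreover have "c ^ (n div 2) = c ^ j * c ^ (n div 2 - j)" if "j \<le> n div 2" for j
    using that by (simp flip: power_add)
  ultimately show ?thesis
    unfolding recip_P_chain_sum sum_distrib_left
    by (intro sum.cong) (auto simp: power_mult_distrib algebra_simps)
qed

lemma recip_P_0_0_1: "recip_P n (\<lambda>_. 0) 0 1 = (1 :: 'a :: comm_ring_1)"
proof -
  have "chain_sum n (\<lambda>i. 0 + 0) j = (0 :: 'a)" if "j > 0" for j
    using that unfolding chain_sum_def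
    by (intro sum.neutral ballI) (auto simp: sparse_chains_def power_0_left)
  then have "recip_P n (\<lambda>_. 0) 0 1 = (\<Sum>j\<in>{0}. (- 1) ^ j * chain_sum n (\<lambda>i. 0 + 0) j * (1 :: 'a))"
    unfolding recip_P_chain_sum by (intro sum.mono_neutral_cong_right) auto
  then show ?thesis by simp
qed

lemma recip_P_monic:
  fixes \<xi> :: "nat \<Rightarrow> 'a :: comm_ring_1"
  shows "degree (recip_P n (\<lambda>i. [:\<xi> i:]) [:\<rho>:] [:0, 1:]) \<le> n div 2"
    and "coeff (recip_P n (\<lambda>i. [:\<xi> i:]) [:\<rho>:] [:0, 1:]) (n div 2) = 1"
  using coeff_recip_P_top[of "\<lambda>i. [:\<xi> i:]" 1 "[:\<rho>:]" "[:0, 1:]" n] by (simp_all add: recip_P_0_0_1)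

section \<open>Homogeneity\<close>

text \<open>Inductive, so that closure under sums and products follows by rule induction; the
  monomial form demanded by \<open>homogeneous_polynomial\<close> is produced only once, at the
  end.\<close>

inductive hom_poly :: "nat set \<Rightarrow> nat \<Rightarrow> ((nat \<Rightarrow> real) \<Rightarrow> real) \<Rightarrow> bool" for I where
  zero: "hom_poly I d (\<lambda>x. 0)"
| const: "hom_poly I 0 (\<lambda>x. a)"
| var: "i \<in> I \<Longrightarrow> hom_poly I d g \<Longrightarrow> hom_poly I (Suc d) (\<lambda>x. x i * g x)"
| add: "hom_poly I d g \<Longrightarrow> hom_poly I d h \<Longrightarrow> hom_poly I d (\<lambda>x. g x + h x)"

lemma hom_poly_sum:
  "(\<And>s. s \<in> S \<Longrightarrow> hom_poly I d (g s)) \<Longrightarrow> hom_poly I d (\<lambda>x. \<Sum>s\<in>S. g s x)"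
  by (induction S rule: infinite_finite_induct) (auto intro: hom_poly.intros)

lemma hom_poly_cmult: "hom_poly I d g \<Longrightarrow> hom_poly I d (\<lambda>x. a * g x)"
proof (induction rule: hom_poly.induct)
  case (var i d g)
  then have "hom_poly I (Suc d) (\<lambda>x. x i * (a * g x))" by (intro hom_poly.var)
  then show ?case by (simp add: mult.left_commute)
qed (auto simp: distrib_left intro: hom_poly.intros)

lemma hom_poly_mult:
  "hom_poly I d g \<Longrightarrow> hom_poly I e h \<Longrightarrow> hom_poly I (d + e) (\<lambda>x. g x * h x)"
  by (induction rule: hom_poly.induct)
     (auto simp: mult.assoc distrib_right intro: hom_poly.intros hom_poly_cmult)

lemma hom_poly_var: "i \<in> I \<Longrightarrow> hom_poly I 1 (\<lambda>x. x i)"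
  using hom_poly.var[OF _ hom_poly.const[of I 1], of i] by simp

lemma hom_poly_0D: "hom_poly I 0 g \<Longrightarrow> \<exists>c. \<forall>x. g x = c"
proof -
  have "hom_poly I d g \<Longrightarrow> d = 0 \<Longrightarrow> \<exists>c. \<forall>x. g x = c" for d
    by (induction rule: hom_poly.induct) auto
  then show "hom_poly I 0 g \<Longrightarrow> \<exists>c. \<forall>x. g x = c" by simp
qed

lemma hom_poly_1D:
  assumes "finite I" "hom_poly I 1 g"
  shows "\<exists>c. \<forall>x. g x = (\<Sum>i\<in>I. c i * x i)"
proof -
  have "hom_poly I d g \<Longrightarrow> d = 1 \<Longrightarrow> \<exists>c. \<forall>x. g x = (\<Sum>i\<in>I. c i * x i)" for d
  proof (induction rule: hom_poly.induct)
    case (zero d)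
    show ?case by (rule exI[of _ "\<lambda>_. 0"]) simp
  next
    case (var i d g)
    then obtain c where c: "\<And>x. g x = c" using hom_poly_0D[of I g] by auto
    show ?case
      using var assms(1)
      by (intro exI[of _ "\<lambda>k. if k = i then c else 0"]) (simp add: c if_distrib[of "\<lambda>a. a * _"] cong: if_cong)
  next
    case (add d g h)
    then obtain c c' where "\<And>x. g x = (\<Sum>i\<in>I. c i * x i)" "\<And>x. h x = (\<Sum>i\<in>I. c' i * x i)" by blast
    then show ?case
      by (intro exI[of _ "\<lambda>i. c i + c' i"]) (simp add: distrib_right sum.distrib)
  qed simp
  then show ?thesis using assms(2) by simp
qed

abbreviation exponents :: "nat set \<Rightarrow> nat \<Rightarrow> (nat \<Rightarrow> nat) set" where
  "exponents I d \<equiv> {\<alpha>. (\<forall>i. i \<notin> I \<longrightarrow> \<alpha> i = 0) \<and> sum \<alpha> I = d}"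

lemma finite_exponents:
  assumes "finite I"
  shows "finite (exponents I d)"
proof (rule finite_subset)
  show "exponents I d \<subseteq> {\<alpha>. \<forall>i. (i \<in> I \<longrightarrow> \<alpha> i \<in> {..d}) \<and> (i \<notin> I \<longrightarrow> \<alpha> i = 0)}"
    using assms by (auto intro: member_le_sum)
  show "finite {\<alpha>. \<forall>i. (i \<in> I \<longrightarrow> \<alpha> i \<in> {..d}) \<and> (i \<notin> I \<longrightarrow> \<alpha> i = (0::nat))}"
    using assms by (rule finite_set_of_finite_funs) simp
qed

lemma homogeneous_polynomial_hom_poly:
  assumes I: "finite I" and "hom_poly I d g"
  shows "homogeneous_polynomial I d g"
  using assms(2)
proof (induction rule: hom_poly.induct)
  case (zero d)
  show ?case unfolding homogeneous_polynomial_def by (rule exI[of _ "\<lambda>_. 0"]) simp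
next
  case (const a)
  have "exponents I 0 = {\<lambda>_. 0}" using I by (auto simp: fun_eq_iff)
  then show ?case unfolding homogeneous_polynomial_def by (intro exI[of _ "\<lambda>_. a"]) simp
next
  case (var i d g)
  then obtain c where c: "\<And>x. g x = (\<Sum>\<alpha>\<in>exponents I d. c \<alpha> * (\<Prod>i\<in>I. x i ^ \<alpha> i))"
    by (auto simp: homogeneous_polynomial_def)
  \<comment> \<open>Multiplication by x_i raises the exponent at i. \<open>?dn\<close> inverts this
    on exponents positive at i; the remaining monomials get coefficient 0.\<close>
  let ?up = "\<lambda>\<alpha> :: nat \<Rightarrow> nat. \<alpha>(i := Suc (\<alpha> i))" and ?dn = "\<lambda>\<alpha> :: nat \<Rightarrow> nat. \<alpha>(i := \<alpha> i - 1)"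
  let ?c = "\<lambda>\<beta>. if \<beta> i > 0 then c (?dn \<beta>) else 0"
  have sum_up: "sum (?up \<alpha>) I = Suc (sum \<alpha> I)" for \<alpha>
    using I var(1) by (simp add: sum.remove[OF I var(1)])
  have prod_up: "(\<Prod>k\<in>I. x k ^ ?up \<alpha> k) = x i * (\<Prod>k\<in>I. x k ^ \<alpha> k)" for \<alpha> and x :: "nat \<Rightarrow> real"
    using I var(1) by (simp add: prod.remove[OF I var(1)] mult.assoc)
  have "x i * g x = (\<Sum>\<beta>\<in>exponents I (Suc d). ?c \<beta> * (\<Prod>k\<in>I. x k ^ \<beta> k))" for x
  proof -
    have "x i * g x = (\<Sum>\<alpha>\<in>exponents I d. c \<alpha> * (\<Prod>k\<in>I. x k ^ ?up \<alpha> k))"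
      unfolding c sum_distrib_left prod_up by (simp add: mult_ac)
    also have "\<dots> = (\<Sum>\<beta>\<in>{\<beta> \<in> exponents I (Suc d). \<beta> i > 0}. c (?dn \<beta>) * (\<Prod>k\<in>I. x k ^ \<beta> k))"
    proof (rule sum.reindex_bij_witness[of _ ?dn ?up])
      fix \<beta> assume \<beta>: "\<beta> \<in> {\<beta> \<in> exponents I (Suc d). \<beta> i > 0}"
      then show e: "?up (?dn \<beta>) = \<beta>" by auto
      have "Suc (sum (?dn \<beta>) I) = Suc d" using sum_up[of "?dn \<beta>"] \<beta> unfolding e by simp
      then show "?dn \<beta> \<in> exponents I d" using \<beta> by auto
    next
      fix \<alpha> assume "\<alpha> \<in> exponents I d"
      then show "?up \<alpha> \<in> {\<beta> \<in> exponents I (Suc d). \<beta> i > 0}"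
        using sum_up[of \<alpha>] var(1) by auto
    qed auto
    also have "\<dots> = (\<Sum>\<beta>\<in>exponents I (Suc d). ?c \<beta> * (\<Prod>k\<in>I. x k ^ \<beta> k))"
      using finite_exponents[OF I, of "Suc d"] by (intro sum.mono_neutral_cong_left) auto
    finally show ?thesis .
  qed
  then show ?case unfolding homogeneous_polynomial_def by (intro exI[of _ ?c]) simp
next
  case (add d g h)
  then obtain c c' where
    "\<And>x. g x = (\<Sum>\<alpha>\<in>exponents I d. c \<alpha> * (\<Prod>i\<in>I. x i ^ \<alpha> i))"
    "\<And>x. h x = (\<Sum>\<alpha>\<in>exponents I d. c' \<alpha> * (\<Prod>i\<in>I. x i ^ \<alpha> i))"
    by (auto simp: homogeneous_polynomial_def)
  then show ?case unfolding homogeneous_polynomial_def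
    by (intro exI[of _ "\<lambda>\<alpha>. c \<alpha> + c' \<alpha>"]) (simp add: distrib_right sum.distrib)
qed

text \<open>Degree \<open>d\<close> is counted jointly in \<open>x\<close> and the indeterminate \<open>\<rho>\<close> of \<open>G x\<close>.\<close>

definition joint_hom :: "nat set \<Rightarrow> nat \<Rightarrow> ((nat \<Rightarrow> real) \<Rightarrow> real poly) \<Rightarrow> bool" where
  "joint_hom I d G \<longleftrightarrow>
     (\<forall>x. degree (G x) \<le> d) \<and> (\<forall>j\<le>d. hom_poly I (d - j) (\<lambda>x. coeff (G x) j))"

lemma joint_hom_sum:
  "(\<And>s. s \<in> S \<Longrightarrow> joint_hom I d (G s)) \<Longrightarrow> joint_hom I d (\<lambda>x. \<Sum>s\<in>S. G s x)"
  by (cases "finite S")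
     (auto simp: joint_hom_def coeff_sum intro!: degree_sum_le hom_poly_sum hom_poly.zero)

lemma joint_hom_const: "joint_hom I 0 (\<lambda>x. [:a:])"
  by (auto simp: joint_hom_def intro: hom_poly.intros)

lemma joint_hom_mult:
  assumes G: "joint_hom I d G" and H: "joint_hom I e H"
  shows "joint_hom I (d + e) (\<lambda>x. G x * H x)"
  unfolding joint_hom_def
proof safe
  show "degree (G x * H x) \<le> d + e" for x
    using G H by (auto simp: joint_hom_def intro!: degree_mult_le[THEN order.trans] add_mono)
  fix j assume j: "j \<le> d + e"
  have "hom_poly I (d + e - j) (\<lambda>x. coeff (G x) i * coeff (H x) (j - i))" if i: "i \<le> j" for i
  proof (cases "i \<le> d \<and> j - i \<le> e")
    case True
    then have eq: "d + e - j = (d - i) + (e - (j - i))" using i by arith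
    show ?thesis unfolding eq
      by (rule hom_poly_mult) (use G H True in \<open>auto simp: joint_hom_def\<close>)
  next
    case False
    then have eq0: "coeff (G x) i * coeff (H x) (j - i) = 0" for x
      using G H by (auto simp: joint_hom_def not_le intro!: coeff_eq_0 intro: le_less_trans)
    show ?thesis unfolding eq0 by (rule hom_poly.zero)
  qed
  then show "hom_poly I (d + e - j) (\<lambda>x. coeff (G x * H x) j)"
    unfolding coeff_mult by (intro hom_poly_sum) simp
qed

lemma joint_hom_linear:
  assumes "hom_poly I 1 g"
  shows "joint_hom I 1 (\<lambda>x. [:g x, a:])"
  using assms by (auto simp: joint_hom_def le_Suc_eq intro: hom_poly.intros)

lemma joint_hom_prod:
  assumes "finite S" "\<And>s. s \<in> S \<Longrightarrow> joint_hom I 1 (G s)"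
  shows "joint_hom I (card S) (\<lambda>x. \<Prod>s\<in>S. G s x)"
  using assms
proof (induction S rule: finite_induct)
  case empty
  show ?case using joint_hom_const[of I 1] by (simp add: one_pCons)
next
  case (insert s S)
  then show ?case using joint_hom_mult[of I 1 "G s" "card S"] by simp
qed

text \<open>A general linear form \<open>L\<close> stands for C because two instances are used: the
  coordinate x_0, which treats C as one more variable, and the form that expresses C by the
  \<xi>_i.\<close>

lemma joint_hom_recip_P:
  assumes I: "{1..<n} \<subseteq> I" and L: "hom_poly I 1 L"
  shows "joint_hom I (n div 2) (\<lambda>x. recip_P n (\<lambda>i. [:x i:]) [:0, 1:] [:L x, a:])"
proof -
  have chain: "joint_hom I j (\<lambda>x. \<Prod>i\<in>S. ([:x i:] + [:0, 1:]))" if "S \<in> sparse_chains n j" for S j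
  proof -
    have "card S = j" "S \<subseteq> I" "finite S" using that I sparse_chains_finite[OF that]
      by (auto simp: sparse_chains_def)
    then show ?thesis
      using joint_hom_prod[of S I "\<lambda>i x. [:x i:] + [:0, 1:]"]
      by (auto intro!: joint_hom_linear[OF hom_poly_var, simplified])
  qed
  have pw: "joint_hom I r (\<lambda>x. [:L x, a:] ^ r)" for r
    using joint_hom_prod[of "{..<r}" I "\<lambda>_ x. [:L x, a:]"] joint_hom_linear[OF L] by simp
  have h: "joint_hom I (0 + (j + (n div 2 - j)))
      (\<lambda>x. [:(- 1) ^ j:] * ((\<Sum>S\<in>sparse_chains n j. \<Prod>i\<in>S. ([:x i:] + [:0, 1:])) * [:L x, a:] ^ (n div 2 - j)))" for j
    by (intro joint_hom_mult joint_hom_const joint_hom_sum chain pw)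
  have sgn: "[:(- 1) ^ j:] = ((- 1) ^ j :: real poly)" for j
    by (cases "even j") (auto simp: one_pCons)
  have t: "joint_hom I (n div 2)
      (\<lambda>x. (- 1) ^ j * (\<Sum>S\<in>sparse_chains n j. \<Prod>i\<in>S. ([:x i:] + [:0, 1:])) * [:L x, a:] ^ (n div 2 - j))"
    if "j \<in> {0..n div 2}" for j
  proof -
    have "0 + (j + (n div 2 - j)) = n div 2" using that by simp
    then show ?thesis using h[of j] by (simp only: sgn mult.assoc)
  qed
  show ?thesis unfolding recip_P_def by (intro joint_hom_sum t)
qed

section \<open>Chebyshev nodes and the system of equations\<close>

lemma poly_roots_eq:
  fixes p :: "'a :: idom poly"
  assumes "p \<noteq> 0" "degree p \<le> card S" "\<And>s. s \<in> S \<Longrightarrow> poly p s = 0"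
  shows "{x. poly p x = 0} = S"
proof -
  have "S = {x. poly p x = 0}"
    using assms card_poly_roots_bound[OF assms(1)]
    by (intro card_seteq poly_roots_finite) auto
  then show ?thesis ..
qed

text \<open>If the derivative vanished too, p / (x - r) would vanish on all of \<open>S\<close>,
  which is more roots than its degree allows.\<close>

lemma pderiv_nonzero_at_root:
  fixes p :: "'a :: idom poly"
  assumes "p \<noteq> 0" "degree p \<le> card S" "\<And>s. s \<in> S \<Longrightarrow> poly p s = 0" "r \<in> S"
  shows "poly (pderiv p) r \<noteq> 0"
proof
  assume r: "poly (pderiv p) r = 0"
  obtain h where h: "p = [:- r, 1:] * h"
    using assms(3)[OF assms(4)] by (auto simp: poly_eq_0_iff_dvd elim: dvdE)
  have "h \<noteq> 0" using assms(1) h by auto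
  have "poly (pderiv p) r = poly h r" unfolding h pderiv_mult by (simp add: pderiv_pCons)
  have "poly h s = 0" if "s \<in> S" for s
  proof (cases "s = r")
    case True
    then show ?thesis using r \<open>poly (pderiv p) r = poly h r\<close> by simp
  next
    case False
    then show ?thesis using assms(3)[OF that] by (simp add: h)
  qed
  then have "card S \<le> card {x. poly h x = 0}"
    using \<open>h \<noteq> 0\<close> by (intro card_mono poly_roots_finite) auto
  also have "\<dots> \<le> degree h" using \<open>h \<noteq> 0\<close> by (rule card_poly_roots_bound)
  also have "\<dots> < degree p" using \<open>h \<noteq> 0\<close> unfolding h by (subst degree_mult_eq) auto
  finally show False using assms(2) by simp
qed

lemma recip_P_xi_0:
  "recip_P n (\<lambda>_. 0) R Z =
     (\<Sum>j\<le>n div 2. (- 1) ^ j * of_nat (card (sparse_chains n j)) * R ^ j * Z ^ (n div 2 - j))"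
proof -
  have "chain_sum n (\<lambda>i. 0 + R) j = of_nat (card (sparse_chains n j)) * R ^ j" for j
  proof -
    have "chain_sum n (\<lambda>i. 0 + R) j = (\<Sum>S\<in>sparse_chains n j. R ^ j)"
      unfolding chain_sum_def by (rule sum.cong) (auto simp: sparse_chains_def)
    then show ?thesis by simp
  qed
  then show ?thesis by (simp add: recip_P_chain_sum mult.assoc)
qed

lemma recip_P_cong:
  assumes "\<And>i. i \<in> {1..<n} \<Longrightarrow> \<xi> i = \<xi>' i"
  shows "recip_P n \<xi> \<rho> \<zeta> = recip_P n \<xi>' \<rho> \<zeta>"
proof -
  have "(\<Sum>S\<in>sparse_chains n j. \<Prod>i\<in>S. (\<xi> i + \<rho>)) = (\<Sum>S\<in>sparse_chains n j. \<Prod>i\<in>S. (\<xi>' i + \<rho>))" for j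
    by (intro sum.cong prod.cong refl) (use assms in \<open>auto simp: sparse_chains_def\<close>)
  then show ?thesis by (simp add: recip_P_def)
qed

section \<open>The roots of P_n for \<xi> = 0 and \<rho> = 1\<close>

definition chebyshev_node :: "nat \<Rightarrow> nat \<Rightarrow> real" where
  "chebyshev_node n k = 2 * cos (real k * pi / real (n + 1))"

lemma node_angle:
  assumes "k \<in> {1..n div 2}"
  shows "0 < real k * pi / real (n + 1)" "real k * pi / real (n + 1) < pi / 2"
proof -
  have k: "1 \<le> k" "2 * k < n + 1" using assms by auto
  then show "0 < real k * pi / real (n + 1)" by simp
  have "real k * 2 < real (n + 1)" using k by linarith
  then have "(real k * 2) * pi < real (n + 1) * pi" by (intro mult_strict_right_mono) auto
  then show "real k * pi / real (n + 1) < pi / 2" by (simp add: field_simps)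
qed

lemma chebyshev_node_pos: "k \<in> {1..n div 2} \<Longrightarrow> chebyshev_node n k > 0"
  unfolding chebyshev_node_def using node_angle[of k n] by (intro mult_pos_pos cos_gt_zero) auto

lemma inj_on_chebyshev_node_sq: "inj_on (\<lambda>k. (chebyshev_node n k)\<^sup>2) {1..n div 2}"
proof (rule inj_onI)
  fix j k assume jk: "j \<in> {1..n div 2}" "k \<in> {1..n div 2}"
    and "(chebyshev_node n j)\<^sup>2 = (chebyshev_node n k)\<^sup>2"
  then have "chebyshev_node n j = chebyshev_node n k"
    using chebyshev_node_pos[OF jk(1)] chebyshev_node_pos[OF jk(2)] by (simp add: power2_eq_iff)
  then have "cos (real j * pi / real (n + 1)) = cos (real k * pi / real (n + 1))"
    by (simp add: chebyshev_node_def)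
  moreover have "0 \<le> real i * pi / real (n + 1) \<and> real i * pi / real (n + 1) \<le> pi"
    if "i \<in> {1..n div 2}" for i
    using node_angle[OF that] pi_half_less_two pi_gt_zero by linarith
  ultimately have "real j * pi / real (n + 1) = real k * pi / real (n + 1)"
    using jk by (metis cos_inj_pi)
  then show "j = k" by simp
qed

lemma recip_P_node:
  assumes "k \<in> {1..n div 2}"
  shows "recip_P n (\<lambda>_. 0) 1 ((chebyshev_node n k)\<^sup>2) = (0 :: real)"
proof -
  let ?t = "real k * pi / real (n + 1)"
  have "sin ?t > 0" using node_angle[OF assms] pi_gt_zero by (intro sin_gt_zero) linarith+
  moreover have "recip_K n (\<lambda>_. 1) (chebyshev_node n k) * sin ?t = 0"
    unfolding chebyshev_node_def recip_K_Chebyshev using sin_npi[of k] by simp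
  ultimately have "recip_K n (\<lambda>i. 0 + 1) (chebyshev_node n k) = 0" by simp
  then show ?thesis
    unfolding recip_K_eq_P using chebyshev_node_pos[OF assms] by simp
qed

context
  fixes n :: nat and q :: "'a :: {idom,real_algebra_1} poly"
  defines "q \<equiv> recip_P n (\<lambda>_. 0) 1 [:0, 1:]"
begin

text \<open>The ring is generic for two instances: the reals, where the roots are shown to be
  simple, and the complex numbers, where the roots determine F^2.\<close>

lemma path_poly_props:
  defines "S \<equiv> (\<lambda>k. of_real ((chebyshev_node n k)\<^sup>2)) ` {1..n div 2}"
  shows "q \<noteq> 0" "degree q \<le> card S" "\<And>s. s \<in> S \<Longrightarrow> poly q s = 0"
proof -
  have "inj_on (\<lambda>k. of_real ((chebyshev_node n k)\<^sup>2) :: 'a) {1..n div 2}"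
    using inj_on_chebyshev_node_sq[of n] by (simp only: inj_on_def of_real_eq_iff)
  then have card: "card S = n div 2" unfolding S_def by (simp add: card_image)
  show "degree q \<le> card S"
    unfolding card q_def using recip_P_monic(1)[of n "\<lambda>_. 0 :: 'a" 1] by (simp add: one_pCons)
  have "coeff q (n div 2) = 1"
    unfolding q_def using recip_P_monic(2)[of n "\<lambda>_. 0 :: 'a" 1] by (simp add: one_pCons)
  then show "q \<noteq> 0" by auto
  show "poly q s = 0" if s: "s \<in> S" for s
  proof -
    obtain k where k: "k \<in> {1..n div 2}" "s = of_real ((chebyshev_node n k)\<^sup>2)"
      using s unfolding S_def by blast
    have "poly q s = of_real (recip_P n (\<lambda>_. 0) 1 ((chebyshev_node n k)\<^sup>2))"
      by (simp add: q_def poly_recip_P k of_real_recip_P)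
    then show ?thesis by (simp add: recip_P_node[OF k(1)])
  qed
qed

end

lemma recip_P_0_1_eq_0D:
  fixes z :: "'a :: {idom,real_algebra_1}"
  assumes "recip_P n (\<lambda>_. 0) 1 z = 0"
  shows "\<exists>k\<in>{1..n div 2}. z = of_real ((chebyshev_node n k)\<^sup>2)"
  using poly_roots_eq[OF path_poly_props[where ?'a = 'a and n = n]] assms
  by (auto simp: poly_recip_P set_eq_iff)

lemma recip_f_top:
  "recip_f n (n div 2) \<xi> C X = recip_P n (\<lambda>_. 0) 1 (X\<^sup>2)"
  using coeff_recip_P_top(2)[of "\<lambda>i. [:\<xi> i:]" 1 "[:0, 1:]" "[:C, X\<^sup>2:]" n]
  by (simp add: recip_f_def)

text \<open>For \<xi> = 0 homogeneity gives P_n(1 + \<rho> X^2) = \<rho>^m q(X^2 + 1/\<rho>), where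
  q is P_n at \<rho> = 1; so the coefficient of \<rho>^(m-1) is the linear Taylor coefficient of q
  at X^2. The proof compares terms.\<close>

lemma recip_f_pderiv:
  assumes "n div 2 \<ge> 1"
  shows "recip_f n (n div 2 - 1) (\<lambda>_. 0) 1 X = poly (pderiv (recip_P n (\<lambda>_. 0) 1 [:0, 1:])) (X\<^sup>2)"
proof -
  let ?m = "n div 2" and ?N = "\<lambda>j. (- 1) ^ j * real (card (sparse_chains n j))"
  have N: "(- 1) ^ j * of_nat (card (sparse_chains n j)) * p = smult (?N j) p" for j p
    by (cases "even j") (simp_all add: of_nat_poly)
  have c: "coeff ([:0, 1:] ^ j * [:1, X\<^sup>2:] ^ (?m - j)) (?m - 1) = real (?m - j) * (X\<^sup>2) ^ (?m - j - 1)"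
    if j: "j \<le> ?m" for j
  proof (cases "?m - j")
    case 0
    then have "j = ?m" using j by simp
    moreover have "([:0, 1:] :: real poly) ^ ?m = monom 1 ?m" by (simp add: monom_altdef)
    ultimately show ?thesis using assms by simp
  next
    case (Suc r)
    then have e: "?m - 1 = j + r" by auto
    have "coeff ([:1, X\<^sup>2:] ^ Suc r) r = real (Suc r choose r) * (X\<^sup>2) ^ r * 1 ^ (Suc r - r)"
      by (rule coeff_linear_poly_power) simp
    then have "coeff ([:1, X\<^sup>2:] ^ Suc r) r = real (Suc r) * (X\<^sup>2) ^ r"
      by simp
    moreover have "([:0, 1:] :: real poly) ^ j = monom 1 j" by (simp add: monom_altdef)
    ultimately show ?thesis unfolding e Suc by (simp only: coeff_monom_mult) simp
  qed
  have "recip_f n (?m - 1) (\<lambda>_. 0) 1 X =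
      (\<Sum>j\<le>?m. ?N j * coeff ([:0, 1:] ^ j * [:1, X\<^sup>2:] ^ (?m - j)) (?m - 1))"
    by (simp add: recip_f_def recip_P_xi_0 mult.assoc[of _ "_ ^ _" "_ ^ _"] N coeff_sum)
  also have "\<dots> = (\<Sum>j\<le>?m. ?N j * (real (?m - j) * (X\<^sup>2) ^ (?m - j - 1)))"
    by (rule sum.cong) (simp_all only: c atMost_iff)
  also have "\<dots> = poly (pderiv (\<Sum>j\<le>?m. smult (?N j) (monom 1 (?m - j)))) (X\<^sup>2)"
    by (simp add: pderiv_sum pderiv_smult pderiv_monom poly_sum poly_monom)
  also have "(\<Sum>j\<le>?m. smult (?N j) (monom 1 (?m - j))) = recip_P n (\<lambda>_. 0) 1 [:0, 1:]"
    by (simp add: recip_P_xi_0 N monom_altdef)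
  finally show ?thesis .
qed

text \<open>For \<zeta> = - c the signs (-1)^j and (-1)^(m-j) combine to (-1)^m in every summand, so
  nothing cancels; the summand j = 0 is strictly positive.\<close>

lemma recip_P_alternating_pos:
  fixes c :: real
  assumes c: "c > 0" and \<xi>: "\<And>i. \<xi> i \<ge> 0"
  shows "(- 1) ^ (n div 2) * recip_P n \<xi> 0 (- c) > 0"
proof -
  have chain: "chain_sum n (\<lambda>i. - \<xi> i + 0) j = (- 1) ^ j * chain_sum n \<xi> j" for j
  proof -
    have "(\<Prod>i\<in>S. - \<xi> i + 0) = (- 1) ^ j * prod \<xi> S" if "S \<in> sparse_chains n j" for S
    proof -
      have "(\<Prod>i\<in>S. - \<xi> i + 0) = (\<Prod>i\<in>S. (- 1) * \<xi> i)" by simp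
      also have "\<dots> = (- 1) ^ card S * prod \<xi> S" by (simp only: prod.distrib prod_constant)
      also have "card S = j" using that by (simp add: sparse_chains_def)
      finally show ?thesis .
    qed
    then show ?thesis unfolding chain_sum_def sum_distrib_left by (intro sum.cong) auto
  qed
  have "(- 1) ^ (n div 2) * recip_P n \<xi> 0 (- c) = recip_P n (\<lambda>i. - \<xi> i) 0 c"
    using recip_P_scale[of n "- 1" \<xi> 0 "- c"] by simp
  also have "\<dots> = (\<Sum>j\<le>n div 2. chain_sum n \<xi> j * c ^ (n div 2 - j))"
  proof -
    have "(- 1) ^ j * ((- 1) ^ j * a) = a" for j and a :: real by (cases "even j") auto
    then show ?thesis unfolding recip_P_chain_sum chain by simp
  qed
  finally have eq: "(- 1) ^ (n div 2) * recip_P n \<xi> 0 (- c) =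
      (\<Sum>j\<le>n div 2. chain_sum n \<xi> j * c ^ (n div 2 - j))" .
  have nonneg: "chain_sum n \<xi> j \<ge> 0" for j
    unfolding chain_sum_def by (intro sum_nonneg prod_nonneg) (use \<xi> in auto)
  show ?thesis unfolding eq
  proof (rule sum_pos2[of _ 0])
    show "0 < chain_sum n \<xi> 0 * c ^ (n div 2 - 0)" using c by simp
  qed (use nonneg c in auto)
qed

context
  fixes n k :: nat and X :: real
  assumes k: "k \<in> {1..n div 2}"
  defines "X \<equiv> chebyshev_node n k"
begin

lemma recip_f_top_node: "recip_f n (n div 2) \<xi> C X = 0"
  unfolding recip_f_top X_def by (rule recip_P_node[OF k])

lemma recip_f_linear:
  "\<exists>a c. a \<noteq> 0 \<and> (\<forall>x C. recip_f n (n div 2 - 1) x C X = a * C + (\<Sum>i = 1..<n. c i * x i))"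
proof -
  have n: "n > 0" "n div 2 \<ge> 1" using k by auto
  \<comment> \<open>C is stored in the coordinate x_0, which no chain uses; joint linearity in C and
    \<xi> is then homogeneity of degree 1.\<close>
  have "hom_poly {0..<n} 1 (\<lambda>x. x 0)" using n by (intro hom_poly_var) simp
  then have "joint_hom {0..<n} (n div 2) (\<lambda>x. recip_P n (\<lambda>i. [:x i:]) [:0, 1:] [:x 0, X\<^sup>2:])"
    by (intro joint_hom_recip_P) auto
  moreover have "n div 2 - (n div 2 - 1) = 1" using n by simp
  ultimately have "hom_poly {0..<n} 1 (\<lambda>x. recip_f n (n div 2 - 1) x (x 0) X)"
    by (auto simp: joint_hom_def recip_f_def dest!: spec[of _ "n div 2 - 1"])
  then obtain c where c: "\<And>x. recip_f n (n div 2 - 1) x (x 0) X = (\<Sum>i\<in>{0..<n}. c i * x i)"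
    using hom_poly_1D[of "{0..<n}"] by blast
  have lin: "recip_f n (n div 2 - 1) x C X = c 0 * C + (\<Sum>i = 1..<n. c i * x i)" for x C
  proof -
    have "recip_f n (n div 2 - 1) x C X = recip_f n (n div 2 - 1) (x(0 := C)) ((x(0 := C)) 0) X"
      unfolding recip_f_def by (subst recip_P_cong[where \<xi>' = "\<lambda>i. [:(x(0 := C)) i:]"]) auto
    also have "\<dots> = c 0 * C + (\<Sum>i = 1..<n. c i * x i)"
      unfolding c using n by (simp add: sum.atLeast_Suc_lessThan)
    finally show ?thesis .
  qed
  \<comment> \<open>The coefficient of C is the derivative at a simple root.\<close>
  have "c 0 = recip_f n (n div 2 - 1) (\<lambda>_. 0) 1 X" unfolding lin by simp
  also have "\<dots> \<noteq> 0"
    unfolding recip_f_pderiv[OF n(2)] X_def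
    by (rule pderiv_nonzero_at_root[OF path_poly_props]) (use k in auto)
  finally show ?thesis using lin by blast
qed

lemma minor_sq_linear: "\<exists>c. \<forall>x C. recip_f n (n div 2 - 1) x C X = 0 \<longleftrightarrow> C = (\<Sum>i = 1..<n. c i * x i)"
proof -
  obtain a c where a: "a \<noteq> 0" and ac: "\<And>x C. recip_f n (n div 2 - 1) x C X = a * C + (\<Sum>i = 1..<n. c i * x i)"
    using recip_f_linear by blast
  have "a * C + (\<Sum>i = 1..<n. c i * x i) = 0 \<longleftrightarrow> C = (\<Sum>i = 1..<n. (- c i / a) * x i)" for x C
  proof -
    have "(\<Sum>i = 1..<n. (- c i / a) * x i) = - (\<Sum>i = 1..<n. c i * x i) / a"
      by (simp add: sum_divide_distrib flip: sum_negf)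
    moreover have "a * C + s = 0 \<longleftrightarrow> C = - s / a" for s using a by (auto simp: field_simps)
    ultimately show ?thesis by simp
  qed
  then show ?thesis unfolding ac by (intro exI[of _ "\<lambda>i. - c i / a"]) blast
qed

lemma minor_sq_iff: "recip_f n (n div 2 - 1) x C X = 0 \<longleftrightarrow> C = minor_sq n x X"
proof -
  obtain c where c: "\<And>x C. recip_f n (n div 2 - 1) x C X = 0 \<longleftrightarrow> C = (\<Sum>i = 1..<n. c i * x i)"
    using minor_sq_linear by blast
  then show ?thesis by (simp add: minor_sq_def)
qed

text \<open>Substituting a linear form for C keeps the joint degree m in \<xi> and \<rho>, which
  leaves m - j for the coefficient of \<rho>^j.\<close>

lemma homogeneous_recip_system:
  assumes "j \<le> n div 2"
  shows "homogeneous_polynomial {1..<n} (n div 2 - j) (\<lambda>x. recip_f n j x (minor_sq n x X) X)"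
proof -
  obtain c where c: "\<And>x C. recip_f n (n div 2 - 1) x C X = 0 \<longleftrightarrow> C = (\<Sum>i = 1..<n. c i * x i)"
    using minor_sq_linear by blast
  then have "minor_sq n x X = (\<Sum>i = 1..<n. c i * x i)" for x by (simp add: minor_sq_def)
  moreover have "hom_poly {1..<n} 1 (\<lambda>x. \<Sum>i = 1..<n. c i * x i)"
    by (intro hom_poly_sum hom_poly_cmult hom_poly_var)
  ultimately have "joint_hom {1..<n} (n div 2) (\<lambda>x. recip_P n (\<lambda>i. [:x i:]) [:0, 1:] [:minor_sq n x X, X\<^sup>2:])"
    by (intro joint_hom_recip_P) auto
  then show ?thesis
    using assms by (intro homogeneous_polynomial_hom_poly) (auto simp: joint_hom_def recip_f_def)
qed

text \<open>Of the m + 1 coefficients, the top one vanishes because X is a node, the next one fixes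
  C, and the others form the system.\<close>

lemma recip_P_line_eq_0_iff:
  "recip_P n (\<lambda>i. [:\<xi> i:]) [:0, 1:] [:C, X\<^sup>2:] = 0 \<longleftrightarrow> C = minor_sq n \<xi> X \<and> recip_system n \<xi> X"
    (is "?p = 0 \<longleftrightarrow> ?rhs")
proof
  assume "?p = 0"
  then have f: "recip_f n j \<xi> C X = 0" for j by (simp add: recip_f_def)
  then have "C = minor_sq n \<xi> X" using minor_sq_iff by blast
  then show ?rhs using f by (simp add: recip_system_def)
next
  assume rhs: ?rhs
  have deg: "degree ?p \<le> n div 2"
    using coeff_recip_P_top(1)[of "\<lambda>i. [:\<xi> i:]" 1 "[:0, 1:]" "[:C, X\<^sup>2:]" n] by simp
  have "coeff ?p j = 0" for j
  proof -
    consider "j < n div 2 - 1" | "j = n div 2 - 1" | "j = n div 2" | "j > n div 2" by linarith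
    then show ?thesis
    proof cases
      case 1
      then show ?thesis using rhs by (auto simp: recip_system_def recip_f_def)
    next
      case 2
      then show ?thesis using minor_sq_iff[of \<xi> C] rhs by (simp add: recip_f_def)
    next
      case 3
      then show ?thesis using recip_f_top_node[of \<xi> C] by (simp add: recip_f_def)
    next
      case 4
      then show ?thesis using deg by (simp add: coeff_eq_0)
    qed
  qed
  then show "?p = 0" by (simp add: poly_eq_iff)
qed

lemma recip_system_recip_P:
  assumes "recip_system n \<xi> X"
  shows "recip_P n \<xi> \<rho> (minor_sq n \<xi> X + \<rho> * X\<^sup>2) = 0"
proof -
  have "recip_P n (\<lambda>i. [:\<xi> i:]) [:0, 1:] [:minor_sq n \<xi> X, X\<^sup>2:] = 0"
    unfolding recip_P_line_eq_0_iff using assms by blast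
  then have "poly (recip_P n (\<lambda>i. [:\<xi> i:]) [:0, 1:] [:minor_sq n \<xi> X, X\<^sup>2:]) \<rho> = 0"
    by (simp only: poly_0)
  then show ?thesis unfolding poly_recip_P by simp
qed

lemma recip_system_of_infinite:
  assumes "infinite {\<rho>. recip_P n \<xi> \<rho> (C + \<rho> * X\<^sup>2) = 0}"
  shows "C = minor_sq n \<xi> X \<and> recip_system n \<xi> X"
proof -
  let ?p = "recip_P n (\<lambda>i. [:\<xi> i:]) [:0, 1:] [:C, X\<^sup>2:]"
  have "{\<rho>. recip_P n \<xi> \<rho> (C + \<rho> * X\<^sup>2) = 0} = {\<rho>. poly ?p \<rho> = 0}"
    unfolding poly_recip_P by simp
  then have "?p = 0" using assms poly_roots_finite[of ?p] by argo
  then show ?thesis unfolding recip_P_line_eq_0_iff .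
qed

text \<open>Makes C the square of a real half-axis: at \<rho> = 0 the identity says that C is a root
  of P_n, and negative roots are excluded.\<close>

lemma minor_sq_nonneg:
  assumes "recip_system n \<xi> X" "\<And>i. \<xi> i \<ge> 0"
  shows "minor_sq n \<xi> X \<ge> 0"
proof (rule ccontr)
  assume "\<not> minor_sq n \<xi> X \<ge> 0"
  then have c: "- minor_sq n \<xi> X > 0" by linarith
  have "recip_P n \<xi> 0 (minor_sq n \<xi> X) = 0"
    using recip_system_recip_P[OF assms(1), of 0] by (simp only: mult_zero_left add_0_right)
  then show False
    using recip_P_alternating_pos[of _ \<xi> n, OF c assms(2)] by (simp only: minus_minus mult_zero_right)
qed

end

section \<open>The Kippenhahn polynomial\<close>

lemma det_tridiagonal_Suc_Suc:
  fixes f :: "nat \<times> nat \<Rightarrow> 'a :: comm_ring_1"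
  assumes tri: "\<And>i j. i \<le> Suc n \<Longrightarrow> j \<le> Suc n \<Longrightarrow> Suc i < j \<or> Suc j < i \<Longrightarrow> f (i, j) = 0"
  shows "det (mat (Suc (Suc n)) (Suc (Suc n)) f) =
      f (Suc n, Suc n) * det (mat (Suc n) (Suc n) f) - f (Suc n, n) * f (n, Suc n) * det (mat n n f)"
proof -
  let ?M = "\<lambda>k. mat k k f"
  \<comment> \<open>The minor belonging to the entry left of the corner; its last column can be
    nonzero only in row n.\<close>
  let ?B = "mat_delete (?M (Suc (Suc n))) (Suc n) n"
  have B: "?B \<in> carrier_mat (Suc n) (Suc n)"
    using mat_delete_carrier[of "?M (Suc (Suc n))" "Suc (Suc n)" "Suc (Suc n)"] by simp
  have last: "mat_delete (?M (Suc (Suc n))) (Suc n) (Suc n) = ?M (Suc n)"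
    by (rule eq_matI) (auto simp: mat_delete_def)
  have "det ?B = (\<Sum>i<Suc n. ?B $$ (i, n) * cofactor ?B i n)"
    by (rule laplace_expansion_column[OF B]) simp
  also have "\<dots> = (\<Sum>i\<in>{n}. ?B $$ (i, n) * cofactor ?B i n)"
  proof (rule sum.mono_neutral_right)
    show "\<forall>i\<in>{..<Suc n} - {n}. ?B $$ (i, n) * cofactor ?B i n = 0"
    proof
      fix i assume "i \<in> {..<Suc n} - {n}"
      then have "?B $$ (i, n) = f (i, Suc n)" "i < n" by (auto simp: mat_delete_def)
      then show "?B $$ (i, n) * cofactor ?B i n = 0" using tri[of i "Suc n"] by simp
    qed
  qed auto
  also have "\<dots> = f (n, Suc n) * det (mat_delete ?B n n)"
    by (simp add: cofactor_def mat_delete_def flip: mult_2)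
  also have "mat_delete ?B n n = ?M n"
    by (rule eq_matI) (auto simp: mat_delete_def)
  finally have detB: "det ?B = f (n, Suc n) * det (?M n)" .
  have "det (?M (Suc (Suc n))) =
      (\<Sum>j<Suc (Suc n). ?M (Suc (Suc n)) $$ (Suc n, j) * cofactor (?M (Suc (Suc n))) (Suc n) j)"
    by (rule laplace_expansion_row) auto
  also have "\<dots> = (\<Sum>j\<in>{n, Suc n}. ?M (Suc (Suc n)) $$ (Suc n, j) * cofactor (?M (Suc (Suc n))) (Suc n) j)"
  proof (rule sum.mono_neutral_right)
    show "\<forall>j\<in>{..<Suc (Suc n)} - {n, Suc n}.
        ?M (Suc (Suc n)) $$ (Suc n, j) * cofactor (?M (Suc (Suc n))) (Suc n) j = 0"
      using tri[of "Suc n"] by auto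
  qed auto
  also have "\<dots> = f (Suc n, Suc n) * det (?M (Suc n)) - f (Suc n, n) * det ?B"
    by (simp add: cofactor_def last flip: mult_2)
  finally show ?thesis by (simp add: detB mult.assoc)
qed

lemma det_tridiagonal_recip_K:
  fixes f :: "nat \<times> nat \<Rightarrow> 'a :: comm_ring_1"
  assumes "\<And>i j. i < n \<Longrightarrow> j < n \<Longrightarrow> Suc i < j \<or> Suc j < i \<Longrightarrow> f (i, j) = 0"
    and "\<And>i. i < n \<Longrightarrow> f (i, i) = - l"
    and "\<And>i. Suc i < n \<Longrightarrow> f (i, Suc i) * f (Suc i, i) = y (Suc i)"
  shows "det (mat n n f) = (- 1) ^ n * recip_K n y l"
  using assms
proof (induction n rule: induct_nat_012)
  case 0
  then show ?case by (simp add: det_dim_zero)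
next
  case 1
  then show ?case by (subst laplace_expansion_row[of _ 1 0])
      (auto simp: cofactor_def det_dim_zero mat_delete_def)
next
  case (ge2 n)
  have "f (Suc n, n) * f (n, Suc n) = y (Suc n)"
    using ge2.prems(3)[of n] by (simp add: mult.commute)
  then show ?case using ge2
    by (subst det_tridiagonal_Suc_Suc) (simp_all add: recip_K_Suc_Suc algebra_simps)
qed

section \<open>Entries of the Hermitian part and the resulting polynomial\<close>

lemma index_mat_adjoint:
  "i < dim_col A \<Longrightarrow> j < dim_row A \<Longrightarrow> mat_adjoint A $$ (i, j) = conjugate (A $$ (j, i))"
  unfolding mat_adjoint_def by (simp add: mat_of_rows_def)

lemma dim_mat_adjoint [simp]: "dim_row (mat_adjoint A) = dim_col A" "dim_col (mat_adjoint A) = dim_row A"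
  by (simp_all add: mat_adjoint_def)

text \<open>By a b = 1 the terms with e^(2 i \<theta>) and its conjugate add up to 4 cos^2 \<theta>
  - 2, and |a| |b| = 1 turns |a|^2 + |b|^2 into (|a| - |b|)^2 + 2; the constants cancel.\<close>

lemma reciprocal_offdiag:
  fixes a b :: complex
  assumes "a * b = 1"
  shows "(cis \<theta> * a + cnj (cis \<theta> * b)) / 2 * ((cis \<theta> * b + cnj (cis \<theta> * a)) / 2) =
    of_real ((cmod a - cmod b)\<^sup>2 / 4 + (cos \<theta>)\<^sup>2)"
proof -
  have cc: "cis \<theta> * cnj (cis \<theta>) = 1" by (simp add: complex_mult_cnj complex_norm_square flip: complex_norm_square)
  have ab: "cnj a * cnj b = 1" using assms by (metis complex_cnj_mult complex_cnj_one)
  have "cmod a * cmod b = 1" using assms by (metis norm_mult norm_one)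
  then have n: "(cmod a - cmod b)\<^sup>2 = (cmod a)\<^sup>2 + (cmod b)\<^sup>2 - 2"
    by (simp add: power2_diff)
  have c2: "of_real (2 * cos \<theta>) = cis \<theta> + cnj (cis \<theta>)"
    by (simp add: complex_add_cnj)
  have "(cis \<theta> * a + cnj (cis \<theta> * b)) * (cis \<theta> * b + cnj (cis \<theta> * a)) =
     (cis \<theta>)\<^sup>2 * (a * b) + (cis \<theta> * cnj (cis \<theta>)) * (a * cnj a) + (cis \<theta> * cnj (cis \<theta>)) * (b * cnj b) + (cnj (cis \<theta>))\<^sup>2 * (cnj a * cnj b)"
    by (simp add: algebra_simps power2_eq_square)
  also have "\<dots> = (cis \<theta>)\<^sup>2 + (cnj (cis \<theta>))\<^sup>2 + of_real ((cmod a)\<^sup>2 + (cmod b)\<^sup>2)"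
    by (simp only: cc ab assms) (simp add: complex_norm_square[symmetric])
  also have "(cis \<theta>)\<^sup>2 + (cnj (cis \<theta>))\<^sup>2 = (cis \<theta> + cnj (cis \<theta>))\<^sup>2 - 2"
    using cc by (simp add: power2_sum)
  also have "\<dots> = of_real (4 * (cos \<theta>)\<^sup>2 - 2)"
    unfolding c2[symmetric] by (simp add: power_mult_distrib)
  finally have prod: "(cis \<theta> * a + cnj (cis \<theta> * b)) * (cis \<theta> * b + cnj (cis \<theta> * a)) =
      of_real (4 * (cos \<theta>)\<^sup>2 - 2) + of_real ((cmod a)\<^sup>2 + (cmod b)\<^sup>2)" .
  have "(cis \<theta> * a + cnj (cis \<theta> * b)) / 2 * ((cis \<theta> * b + cnj (cis \<theta> * a)) / 2) =
      (of_real (4 * (cos \<theta>)\<^sup>2 - 2) + of_real ((cmod a)\<^sup>2 + (cmod b)\<^sup>2)) / 4"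
    unfolding prod[symmetric] by simp
  then show ?thesis by (simp add: n field_simps)
qed

lemma kippenhahn_poly_recip:
  assumes A: "A \<in> reciprocal_matrices n"
  shows "kippenhahn_poly A (of_real l) \<theta> =
     of_real ((- 1) ^ n * (l ^ (n mod 2) * recip_P n (recip_xi A) ((cos \<theta>)\<^sup>2) (l\<^sup>2)))"
proof -
  have dim: "A \<in> carrier_mat n n" and
    tri: "\<And>i j. i < n \<Longrightarrow> j < n \<Longrightarrow> j \<noteq> Suc i \<Longrightarrow> i \<noteq> Suc j \<Longrightarrow> A $$ (i, j) = 0" and
    rec: "\<And>i. Suc i < n \<Longrightarrow> A $$ (i, Suc i) * A $$ (Suc i, i) = 1"
    using A by (auto simp: reciprocal_matrices_def)
  let ?y = "\<lambda>i. of_real (recip_xi A i) + of_real ((cos \<theta>)\<^sup>2) :: complex"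
  define f where "f = (\<lambda>(i, j). (cis \<theta> * A $$ (i, j) + cnj (cis \<theta> * A $$ (j, i))) / 2
      - (if i = j then of_real l else 0))"
  have "Re_mat (cis \<theta> \<cdot>\<^sub>m A) - of_real l \<cdot>\<^sub>m 1\<^sub>m (dim_row A) = mat n n f"
    using dim by (intro eq_matI)
      (auto simp: Re_mat_def f_def index_mat_adjoint conjugate_complex_def)
  moreover have "det (mat n n f) = (- 1) ^ n * recip_K n ?y (of_real l)"
  proof (rule det_tridiagonal_recip_K)
    fix i assume i: "Suc i < n"
    show "f (i, Suc i) * f (Suc i, i) = ?y (Suc i)"
      using reciprocal_offdiag[OF rec[OF i], of \<theta>] by (simp add: f_def recip_xi_def)
  qed (auto simp: f_def tri)
  ultimately show ?thesis
    by (simp add: kippenhahn_poly_def recip_K_eq_P of_real_recip_P)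
qed

section \<open>Critical values of multivalued functions\<close>

text \<open>
  Think of \<open>R t\<close> as a multivalued function of \<open>t\<close>; the values \<open>u\<close> in the last assumption are its
  critical values.  Covering the parameter interval by pieces of length \<open>O(1/k)\<close> covers the critical
  values by \<open>O(N k)\<close> intervals of length \<open>O(e/k)\<close>.
\<close>

lemma critical_values_not_cofinite:
  fixes R :: "real \<Rightarrow> real set"
  assumes fin: "\<And>t. finite (R t)" and card: "\<And>t. card (R t) \<le> N" and V: "finite V"
    and crit: "\<And>u. u \<in> {0..1} - V \<Longrightarrow> \<exists>\<theta>\<in>{-4..4}. \<forall>e>0. \<exists>d>0. \<forall>t. \<bar>t - \<theta>\<bar> < d \<longrightarrow>
                 (\<exists>v\<in>R t. \<bar>v - u\<bar> \<le> e * \<bar>t - \<theta>\<bar>)"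
  shows False
proof -
  \<comment> \<open>The k + 2 grid points carry at most N intervals each, of length 16 e / (k + 1),
    in total at most 32 e N; the 64 keeps this below 1/2.\<close>
  define e :: real where "e = 1 / (64 * (real N + 1))"
  have e: "e > 0" by (simp add: e_def)
  define grid :: "nat \<Rightarrow> nat \<Rightarrow> real" where "grid k i = -4 + 8 * real i / real (Suc k)" for k i
  define r where "r k = e * (8 / real (Suc k))" for k
  have r: "r k > 0" for k using e by (simp add: r_def)
  define U where "U k = (\<Union>i\<in>{..Suc k}. \<Union>v\<in>R (grid k i). {v - r k..v + r k})" for k
  have closed_U: "closed (U k)" for k
    unfolding U_def by (intro closed_UN ballI closed_atLeastAtMost fin finite_atMost)
  have U_le: "emeasure lborel (U k) \<le> ennreal (1 / 2)" for k
  proof -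
    have "emeasure lborel (\<Union>v\<in>R t. {v - r k..v + r k}) \<le> ennreal (real N * (2 * r k))" for t
    proof -
      have "emeasure lborel (\<Union>v\<in>R t. {v - r k..v + r k}) \<le> (\<Sum>v\<in>R t. emeasure lborel {v - r k..v + r k})"
        by (intro emeasure_subadditive_finite fin) auto
      also have "\<dots> = (\<Sum>v\<in>R t. ennreal (2 * r k))"
        using r[of k] by (intro sum.cong) auto
      also have "\<dots> = ennreal (real (card (R t)) * (2 * r k))"
        using r[of k] by (simp add: ennreal_mult ennreal_of_nat_eq_real_of_nat)
      also have "\<dots> \<le> ennreal (real N * (2 * r k))"
        using r[of k] card[of t] by (intro ennreal_leI mult_right_mono) auto
      finally show ?thesis .
    qed
    moreover have "emeasure lborel (U k) \<le> (\<Sum>i\<in>{..Suc k}. emeasure lborel (\<Union>v\<in>R (grid k i). {v - r k..v + r k}))"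
      unfolding U_def by (intro emeasure_subadditive_finite) (auto intro!: borel_closed closed_UN fin)
    ultimately have "emeasure lborel (U k) \<le> (\<Sum>i\<in>{..Suc k}. ennreal (real N * (2 * r k)))"
      by (meson order.trans sum_mono)
    also have "\<dots> = ennreal (real (k + 2) * (real N * (2 * r k)))"
      using r[of k] by (simp add: ennreal_mult ennreal_of_nat_eq_real_of_nat)
    also have "\<dots> \<le> ennreal (1 / 2)"
    proof (rule ennreal_leI)
      have "real (k + 2) * (real N * (2 * r k)) = (real (k + 2) / real (Suc k)) * (16 * e * real N)"
        by (simp add: r_def)
      also have "\<dots> \<le> 2 * (16 * e * real N)"
        using e by (intro mult_right_mono) (auto simp: field_simps)
      also have "\<dots> \<le> 1 / 2" by (simp add: e_def field_simps)
      finally show "real (k + 2) * (real N * (2 * r k)) \<le> 1 / 2" .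
    qed
    finally show ?thesis .
  qed
  \<comment> \<open>The d in the hypothesis depends on u, so u is only known to lie in
    \<open>U j\<close> for large j. Hence the increasing tail intersections, whose union still has
    measure at most 1/2.\<close>
  define W where "W k = (\<Inter>j\<in>{k..}. U j)" for k
  have W_sets: "W k \<in> sets lborel" for k
    using closed_U by (auto simp: W_def intro!: borel_closed closed_INT)
  have incW: "incseq W" by (auto simp: W_def incseq_def)
  have W_le: "emeasure lborel (W k) \<le> ennreal (1 / 2)" for k
    using closed_U by (intro order.trans[OF emeasure_mono U_le[of k]]) (auto simp: W_def intro: borel_closed)
  have "emeasure lborel (\<Union>k. W k) = (SUP k. emeasure lborel (W k))"
    using W_sets incW by (intro SUP_emeasure_incseq[symmetric]) auto
  also have "\<dots> \<le> ennreal (1 / 2)" by (intro SUP_least W_le)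
  finally have le: "emeasure lborel (\<Union>k. W k) \<le> ennreal (1 / 2)" .
  have "{0..1} - V \<subseteq> (\<Union>k. W k)"
  proof
    fix u assume "u \<in> {0..1} - V"
    then obtain \<theta> where \<theta>: "\<theta> \<in> {-4..4}" and near: "\<forall>e>0. \<exists>d>0. \<forall>t. \<bar>t - \<theta>\<bar> < d \<longrightarrow>
                 (\<exists>v\<in>R t. \<bar>v - u\<bar> \<le> e * \<bar>t - \<theta>\<bar>)" using crit by blast
    obtain d where d: "d > 0" "\<And>t. \<bar>t - \<theta>\<bar> < d \<Longrightarrow> \<exists>v\<in>R t. \<bar>v - u\<bar> \<le> e * \<bar>t - \<theta>\<bar>"
      using near e by blast
    obtain k where k: "8 / d < real k" using reals_Archimedean2 by blast
    have "u \<in> U j" if "j \<ge> k" for j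
    proof -
      define J where "J = real (Suc j)"
      have J: "J > 0" "8 / J < d"
        using k that d(1) by (auto simp: J_def field_simps) (smt (verit) mult_left_mono of_nat_mono)
      \<comment> \<open>Position of \<theta> in units of the mesh 8 / J; its floor indexes the
        nearest grid point from below.\<close>
      define x where "x = (\<theta> + 4) * J / 8"
      have x: "0 \<le> x" "x \<le> J" using \<theta> J by (auto simp: x_def)
      define i where "i = nat \<lfloor>x\<rfloor>"
      have i: "real i \<le> x" "x < real i + 1" using x by (auto simp: i_def)
      have "i \<le> Suc j" using i(1) x(2) by (simp add: J_def)
      have "\<theta> = -4 + 8 * x / J" using J by (simp add: x_def)
      then have "grid j i - \<theta> = 8 / J * (real i - x)"
        unfolding grid_def J_def[symmetric] by (simp add: diff_divide_distrib right_diff_distrib)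
      then have "\<bar>grid j i - \<theta>\<bar> = \<bar>8 / J\<bar> * \<bar>real i - x\<bar>" by (simp only: abs_mult)
      also have "\<bar>8 / J\<bar> = 8 / J" using J by simp
      also have "8 / J * \<bar>real i - x\<bar> \<le> 8 / J * 1" using i J by (intro mult_left_mono) auto
      finally have g: "\<bar>grid j i - \<theta>\<bar> \<le> 8 / J" by simp
      then obtain v where v: "v \<in> R (grid j i)" "\<bar>v - u\<bar> \<le> e * \<bar>grid j i - \<theta>\<bar>"
        using d(2)[of "grid j i"] J by force
      have "\<bar>v - u\<bar> \<le> r j"
        using v(2) mult_left_mono[OF g, of e] e by (simp add: r_def J_def)
      then have "u \<in> {v - r j..v + r j}" by auto
      then show ?thesis using v(1) \<open>i \<le> Suc j\<close> unfolding U_def by blast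
    qed
    then have "u \<in> W k" by (auto simp: W_def)
    then show "u \<in> (\<Union>k. W k)" by blast
  qed
  then have "emeasure lborel ({0..1} - V) \<le> emeasure lborel (\<Union>k. W k)"
    using W_sets by (intro emeasure_mono) auto
  moreover have "emeasure lborel ({0..1} - V) = 1"
  proof -
    have "V \<in> null_sets lborel" using V by (rule finite_imp_null_set_lborel)
    then have "emeasure lborel ({0..1} - V) = emeasure lborel {0..1::real}"
      by (intro emeasure_Diff_null_set) auto
    then show ?thesis by simp
  qed
  ultimately have "(1 :: ennreal) \<le> ennreal (1 / 2)" using le by simp
  then have "ennreal 1 \<le> ennreal (1 / 2)" by simp
  then show False by (subst (asm) ennreal_le_iff) auto
qed

section \<open>Small roots of quadratics with a dominant linear term\<close>

lemma quadratic_root_near_0: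
  fixes q D E \<eta> :: real
  assumes "\<eta> \<ge> 0" "\<bar>q\<bar> + \<bar>E\<bar> * \<eta>\<^sup>2 \<le> \<bar>D\<bar> * \<eta>"
  shows "\<exists>x. \<bar>x\<bar> \<le> \<eta> \<and> q + D * x + E * x\<^sup>2 = 0"
proof -
  let ?f = "\<lambda>x. q + D * x + E * x\<^sup>2"
  have cont: "continuous_on {-\<eta>..\<eta>} ?f" by (intro continuous_intros)
  have E: "\<bar>E * \<eta>\<^sup>2\<bar> = \<bar>E\<bar> * \<eta>\<^sup>2" by (simp add: abs_mult)
  have D: "\<bar>D * \<eta>\<bar> = \<bar>D\<bar> * \<eta>" using assms by (simp add: abs_mult)
  have le: "\<bar>q\<bar> + \<bar>E * \<eta>\<^sup>2\<bar> \<le> \<bar>D * \<eta>\<bar>" "- \<eta> \<le> \<eta>" using assms E D by simp_all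
  have "\<exists>x\<ge>-\<eta>. x \<le> \<eta> \<and> ?f x = 0"
  \<comment> \<open>At both ends of the interval the linear term outweighs the other two, so the
    values there have weakly opposite signs.\<close>
  proof (cases "D * \<eta> \<ge> 0")
    case True
    then have "?f (- \<eta>) \<le> 0" "0 \<le> ?f \<eta>" using le(1) unfolding power2_minus mult_minus_right by linarith+
    then show ?thesis using IVT'[of ?f, OF _ _ le(2) cont] by blast
  next
    case False
    then have "?f \<eta> \<le> 0" "0 \<le> ?f (- \<eta>)" using le(1) unfolding power2_minus mult_minus_right by linarith+
    then show ?thesis using IVT2'[of ?f, OF _ _ le(2) cont] by blast
  qed
  then show ?thesis by (auto simp: abs_le_iff)
qed

lemma quadratic_roots_card:
  fixes q0 q1 q2 :: real
  assumes "q0 \<noteq> 0 \<or> q1 \<noteq> 0 \<or> q2 \<noteq> 0"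
  shows "finite {x. q0 + q1 * x + q2 * x\<^sup>2 = 0}" "card {x. q0 + q1 * x + q2 * x\<^sup>2 = 0} \<le> 2"
proof -
  let ?p = "[:q0, q1, q2:]"
  have p: "?p \<noteq> 0" using assms by auto
  have eq: "{x. q0 + q1 * x + q2 * x\<^sup>2 = 0} = {x. poly ?p x = 0}"
    by (simp add: algebra_simps power2_eq_square)
  show "finite {x. q0 + q1 * x + q2 * x\<^sup>2 = 0}" unfolding eq using p by (rule poly_roots_finite)
  have "card {x. poly ?p x = 0} \<le> degree ?p" using p by (rule card_poly_roots_bound)
  also have "\<dots> \<le> 2" by (simp add: numeral_2_eq_2 degree_pCons_le)
  finally show "card {x. q0 + q1 * x + q2 * x\<^sup>2 = 0} \<le> 2" unfolding eq .
qed

text \<open>Replaces the implicit function theorem at a simple root: with coefficients continuous at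
  the single point \<theta> and \<open>q\<close> differentiable there, some root stays within o(|t -
  \<theta>|).\<close>

lemma quadratic_root_little_o:
  fixes q D E :: "real \<Rightarrow> real"
  assumes q: "(q has_real_derivative 0) (at \<theta>)" "q \<theta> = 0"
    and D: "isCont D \<theta>" "D \<theta> \<noteq> 0" and E: "isCont E \<theta>" and e: "e > 0"
  shows "\<exists>d>0. \<forall>t. \<bar>t - \<theta>\<bar> < d \<longrightarrow>
           (\<exists>x. \<bar>x\<bar> \<le> e * \<bar>t - \<theta>\<bar> \<and> q t + D t * x + E t * x\<^sup>2 = 0)"
proof -
  define D0 where "D0 = \<bar>D \<theta>\<bar>"
  define E0 where "E0 = \<bar>E \<theta>\<bar> + 1"
  have pos: "D0 > 0" "E0 > 0" using D(2) by (auto simp: D0_def E0_def)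
  have "((\<lambda>t. (q t - q \<theta>) / (t - \<theta>)) \<longlongrightarrow> 0) (at \<theta>)"
    using q(1) by (simp add: has_field_derivative_iff)
  \<comment> \<open>The constant and the quadratic term each get the share
    \<open>D0 / 4 * \<eta>\<close>; together they stay below the linear term, as |D t| \<ge> D0 /
    2.\<close>
  then have "\<forall>\<^sub>F t in at \<theta>. dist ((q t - q \<theta>) / (t - \<theta>)) 0 < D0 / 4 * e"
    using pos e by (intro tendstoD) auto
  moreover have "\<forall>\<^sub>F t in at \<theta>. dist (D t) (D \<theta>) < D0 / 2"
    using D(1) pos by (intro tendstoD) (auto simp: isCont_def)
  moreover have "\<forall>\<^sub>F t in at \<theta>. dist (E t) (E \<theta>) < 1"
    using E by (intro tendstoD) (auto simp: isCont_def)
  moreover have "\<forall>\<^sub>F t in at \<theta>. dist t \<theta> < D0 / 4 / (E0 * e)"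
    using pos e by (intro tendstoD tendsto_ident_at) auto
  ultimately have "\<forall>\<^sub>F t in at \<theta>. \<exists>x. \<bar>x\<bar> \<le> e * \<bar>t - \<theta>\<bar> \<and> q t + D t * x + E t * x\<^sup>2 = 0"
    using eventually_neq_at_within[of \<theta> \<theta> UNIV]
  proof eventually_elim
    case (elim t)
    define \<eta> where "\<eta> = e * \<bar>t - \<theta>\<bar>"
    have t: "\<bar>t - \<theta>\<bar> > 0" using elim by simp
    have \<eta>: "\<eta> > 0" using t e by (simp add: \<eta>_def)
    have "\<bar>q t\<bar> / \<bar>t - \<theta>\<bar> < D0 / 4 * e" using elim(1) q(2) by (simp add: dist_real_def)
    then have 1: "\<bar>q t\<bar> \<le> D0 / 4 * \<eta>" using t by (simp add: \<eta>_def divide_less_eq mult.assoc)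
    have 2: "\<bar>D t\<bar> \<ge> D0 / 2" using elim(2) unfolding dist_real_def D0_def by linarith
    have 3: "\<bar>E t\<bar> \<le> E0" using elim(3) by (auto simp: dist_real_def E0_def)
    have 4: "E0 * \<eta> \<le> D0 / 4" using elim(4) pos e
      by (simp add: dist_real_def \<eta>_def less_divide_eq mult_ac)
    have "\<bar>E t\<bar> * \<eta>\<^sup>2 \<le> E0 * \<eta> * \<eta>"
      using 3 \<eta> by (simp add: power2_eq_square mult.assoc)
    also have "\<dots> \<le> D0 / 4 * \<eta>" using 4 \<eta> by (intro mult_right_mono) auto
    finally have "\<bar>q t\<bar> + \<bar>E t\<bar> * \<eta>\<^sup>2 \<le> D0 / 2 * \<eta>" using 1 by simp
    also have "\<dots> \<le> \<bar>D t\<bar> * \<eta>" using 2 \<eta> by (intro mult_right_mono) auto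
    finally show ?case using quadratic_root_near_0[of \<eta> "q t" "E t" "D t"] \<eta> by (simp add: \<eta>_def)
  qed
  then obtain d where d: "d > 0" and dt: "\<And>t. t \<noteq> \<theta> \<Longrightarrow> dist t \<theta> < d \<Longrightarrow>
      \<exists>x. \<bar>x\<bar> \<le> e * \<bar>t - \<theta>\<bar> \<and> q t + D t * x + E t * x\<^sup>2 = 0"
    by (auto simp: eventually_at)
  have "\<exists>x. \<bar>x\<bar> \<le> e * \<bar>t - \<theta>\<bar> \<and> q t + D t * x + E t * x\<^sup>2 = 0" if "\<bar>t - \<theta>\<bar> < d" for t
  proof (cases "t = \<theta>")
    case True
    then show ?thesis using q(2) by (intro exI[of _ 0]) simp
  next
    case False
    then show ?thesis using dt that by (simp add: dist_real_def)
  qed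
  then show ?thesis using d by blast
qed

section \<open>Ellipses in the Kippenhahn curve\<close>

lemma support_line_iff: "z \<in> support_line \<theta> l \<longleftrightarrow> Re (cis \<theta> * z) = l"
proof
  assume "z \<in> support_line \<theta> l"
  then obtain t where "z = cis (- \<theta>) * (complex_of_real l + \<i> * complex_of_real t)"
    by (auto simp: support_line_def)
  then have "cis \<theta> * z = complex_of_real l + \<i> * complex_of_real t"
    by (simp add: cis_mult flip: mult.assoc)
  then show "Re (cis \<theta> * z) = l" by simp
next
  assume "Re (cis \<theta> * z) = l"
  then obtain t where "cis \<theta> * z = complex_of_real l + \<i> * complex_of_real t"
    using complex_eq[of "cis \<theta> * z"] by metis
  moreover have "z = cis (- \<theta>) * (cis \<theta> * z)" by (simp add: cis_mult flip: mult.assoc)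
  ultimately show "z \<in> support_line \<theta> l" unfolding support_line_def by (intro CollectI exI[of _ t]) simp
qed

lemma Re_cis_mult: "Re (cis t * z) = cos t * Re z - sin t * Im z"
  by simp

text \<open>The focal distances of this point are \<open>a - f * c\<close> and
  \<open>a + f * c\<close>.\<close>

lemma ellipse_point:
  fixes f b c s \<phi> :: real
  assumes f: "f \<ge> 0" and cs: "c\<^sup>2 + s\<^sup>2 = 1" and F: "F = of_real f * cis \<phi>"
    and a: "a = sqrt (f\<^sup>2 + b\<^sup>2)"
  shows "cis \<phi> * Complex (a * c) (b * s) \<in> centered_ellipse F b"
proof -
  let ?z = "cis \<phi> * Complex (a * c) (b * s)"
  have a2: "a\<^sup>2 = f\<^sup>2 + b\<^sup>2" by (simp add: a)
  have "a \<ge> f" using f unfolding a by (intro real_le_rsqrt) simp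
  moreover have "c\<^sup>2 \<le> 1" using cs zero_le_power2[of s] by linarith
  then have "\<bar>c\<bar> \<le> 1" by (simp add: abs_square_le_1)
  then have "\<bar>f * c\<bar> \<le> f" using f by (simp add: abs_mult mult_left_le)
  ultimately have fc: "\<bar>f * c\<bar> \<le> a" by linarith
  have eq: "(a * c - r)\<^sup>2 + (b * s)\<^sup>2 = (a - r * c)\<^sup>2" if "r\<^sup>2 = f\<^sup>2" for r
  proof -
    have s2: "s\<^sup>2 = 1 - c\<^sup>2" using cs by simp
    have "b\<^sup>2 = a\<^sup>2 - r\<^sup>2" using a2 that by simp
    then have "(a * c - r)\<^sup>2 + (b * s)\<^sup>2 = (a * c - r)\<^sup>2 + (a\<^sup>2 - r\<^sup>2) * (1 - c\<^sup>2)"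
      by (simp only: power_mult_distrib s2)
    also have "\<dots> = (a - r * c)\<^sup>2" by (simp add: power2_eq_square algebra_simps)
    finally show ?thesis .
  qed
  have norm: "cmod (?z - of_real r * cis \<phi>) = \<bar>a - r * c\<bar>" if "r\<^sup>2 = f\<^sup>2" for r
  proof -
    have "?z - of_real r * cis \<phi> = cis \<phi> * Complex (a * c - r) (b * s)"
      by (simp add: complex_eq_iff algebra_simps)
    then show ?thesis using eq[OF that] by (simp add: norm_mult complex_norm)
  qed
  have "cmod (?z - F) = a - f * c" using norm[of f] fc by (simp add: F)
  moreover have "cmod (?z + F) = a + f * c" using norm[of "- f"] fc by (simp add: F)
  moreover have "cmod F = f" using f by (simp add: F norm_mult)
  ultimately show ?thesis by (simp add: centered_ellipse_def a)
qed

lemma kippenhahn_roots: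
  assumes A: "A \<in> reciprocal_matrices n"
  shows "finite {l. kippenhahn_poly A (complex_of_real l) t = 0}"
    and "card {l. kippenhahn_poly A (complex_of_real l) t = 0} \<le> n + 1"
proof -
  let ?q = "recip_P n (\<lambda>i. [:recip_xi A i:]) [:(cos t)\<^sup>2:] [:0, 1:]"
  \<comment> \<open>The extra factor l accounts for odd n; for even n it can only add a root, which
    an upper bound tolerates.\<close>
  let ?p = "[:0, 1:] * pcompose ?q [:0, 0, 1:]"
  have q: "degree ?q \<le> n div 2" "?q \<noteq> 0"
    using recip_P_monic[of n "recip_xi A" "(cos t)\<^sup>2"] by auto
  then have "pcompose ?q [:0, 0, 1:] \<noteq> 0" using pcompose_eq_0[of ?q "[:0, 0, 1:]"] by auto
  then have p: "?p \<noteq> 0" by simp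
  have "degree ?p \<le> 1 + degree ?q * 2"
    using degree_mult_le[of "[:0, 1:]" "pcompose ?q [:0, 0, 1:]"] by (simp add: degree_pcompose)
  then have deg: "degree ?p \<le> n + 1" using q(1) by linarith
  have sub: "{l. kippenhahn_poly A (complex_of_real l) t = 0} \<subseteq> {l. poly ?p l = 0}"
    by (auto simp: kippenhahn_poly_recip[OF A] poly_pcompose poly_recip_P power2_eq_square)
  show "finite {l. kippenhahn_poly A (complex_of_real l) t = 0}"
    using sub poly_roots_finite[OF p] by (rule finite_subset)
  have "card {l. kippenhahn_poly A (complex_of_real l) t = 0} \<le> card {l. poly ?p l = 0}"
    using sub poly_roots_finite[OF p] by (intro card_mono)
  also have "\<dots> \<le> degree ?p" using p by (rule card_poly_roots_bound)
  finally show "card {l. kippenhahn_poly A (complex_of_real l) t = 0} \<le> n + 1" using deg by simp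
qed

text \<open>b^2 + (Re (cis \<theta> F))^2 is the squared support function of the ellipse, so a zero
  of P_n there means that both tangents for this \<theta> belong to the family. With finitely many
  such \<theta>, all but finitely many u in [0, 1] would be critical values.\<close>

lemma infinite_common_tangents:
  assumes A: "A \<in> reciprocal_matrices n" and b: "b > 0"
    and E: "centered_ellipse F b \<subseteq> kippenhahn_curve A"
  shows "infinite {\<theta>\<in>{- pi<..pi}. recip_P n (recip_xi A) ((cos \<theta>)\<^sup>2) (b\<^sup>2 + (Re (cis \<theta> * F))\<^sup>2) = 0}"
    (is "infinite ?T")
proof
  assume fin_T: "finite ?T"
  define f where "f = cmod F"
  define \<phi> where "\<phi> = Arg F"
  define a where "a = sqrt (f\<^sup>2 + b\<^sup>2)"
  have F: "F = of_real f * cis \<phi>" by (simp add: f_def \<phi>_def flip: rcis_def rcis_cmod_Arg)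
  have a2: "a\<^sup>2 = f\<^sup>2 + b\<^sup>2" by (simp add: a_def)
  define C where "C t = a * cos (t + \<phi>)" for t
  define S where "S t = b * sin (t + \<phi>)" for t
  \<comment> \<open>Parameters of the points where the line meets the ellipse; the discriminant 4
    (C^2 + S^2 - l^2) vanishes exactly for tangents.\<close>
  define Q where "Q t l = {v. (C t - l) + (- 2 * S t) * v + (- (C t + l)) * v\<^sup>2 = 0}" for t l
  \<comment> \<open>half-angle parametrization, so that incidence with a line is a quadratic equation in \<open>u\<close>\<close>
  define z where "z u = cis \<phi> * Complex (a * ((1 - u\<^sup>2) / (1 + u\<^sup>2))) (b * (2 * u / (1 + u\<^sup>2)))" for u :: real
  have CS: "(C t)\<^sup>2 + (S t)\<^sup>2 = b\<^sup>2 + (Re (cis t * F))\<^sup>2" for t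
  proof -
    have "Re (cis t * F) = f * cos (t + \<phi>)" unfolding F
      by (simp add: cos_add algebra_simps)
    moreover have "(C t)\<^sup>2 + (S t)\<^sup>2 = b\<^sup>2 + f\<^sup>2 * (cos (t + \<phi>))\<^sup>2"
      by (simp add: C_def S_def power_mult_distrib a2 sin_squared_eq algebra_simps)
    ultimately show ?thesis by (simp add: power_mult_distrib)
  qed
  have pos: "b\<^sup>2 + (Re (cis t * F))\<^sup>2 > 0" for t using b by (simp add: add_pos_nonneg)
  have z_in: "z u \<in> centered_ellipse F b" for u
  proof -
    have "1 + u\<^sup>2 \<noteq> 0" by (smt (verit) zero_le_power2)
    then have "((1 - u\<^sup>2) / (1 + u\<^sup>2))\<^sup>2 + (2 * u / (1 + u\<^sup>2))\<^sup>2 = 1"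
      by (simp add: divide_simps) (simp add: power2_eq_square algebra_simps)
    then show ?thesis unfolding z_def using F by (intro ellipse_point) (auto simp: f_def a_def)
  qed
  have z_line: "(1 + u\<^sup>2) * (Re (cis t * z u) - l) = (C t - l) + (- 2 * S t) * u + (- (C t + l)) * u\<^sup>2" for t u l
  proof -
    have u: "1 + u\<^sup>2 \<noteq> 0" by (smt (verit) zero_le_power2)
    have "cis t * z u = cis (t + \<phi>) * Complex (a * ((1 - u\<^sup>2) / (1 + u\<^sup>2))) (b * (2 * u / (1 + u\<^sup>2)))"
      by (simp add: z_def cis_mult flip: mult.assoc)
    then have "Re (cis t * z u) = C t * ((1 - u\<^sup>2) / (1 + u\<^sup>2)) - S t * (2 * u / (1 + u\<^sup>2))"
      by (simp add: C_def S_def mult_ac)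
    moreover have "w * (x * (p / w) - y * (q / w)) = x * p - y * q" if "w \<noteq> 0" for w x y p q :: real
      using that by (simp add: field_simps)
    ultimately have "(1 + u\<^sup>2) * Re (cis t * z u) = C t * (1 - u\<^sup>2) - S t * (2 * u)"
      using u by metis
    then show ?thesis unfolding right_diff_distrib[of "1 + u\<^sup>2"] by (simp only:) (simp add: algebra_simps)
  qed
  have Q_nontriv: "C t - l \<noteq> 0 \<or> - 2 * S t \<noteq> 0 \<or> - (C t + l) \<noteq> 0" for t l
  proof (rule ccontr)
    assume "\<not> ?thesis"
    then have "C t = 0" "S t = 0" by auto
    then show False using CS[of t] pos[of t] by simp
  qed
  note Q = quadratic_roots_card[OF Q_nontriv, folded Q_def]
  define \<Lambda> where "\<Lambda> t = {l. kippenhahn_poly A (complex_of_real l) t = 0}" for t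
  note \<Lambda> = kippenhahn_roots[OF A, folded \<Lambda>_def]
  define R where "R t = (\<Union>l\<in>\<Lambda> t. Q t l)" for t
  define h where "h t = sqrt (b\<^sup>2 + (Re (cis t * F))\<^sup>2)" for t
  define V where "V = (\<Union>\<theta>\<in>?T. Q \<theta> (h \<theta>) \<union> Q \<theta> (- h \<theta>))"
  show False
  proof (rule critical_values_not_cofinite)
    show "finite (R t)" for t unfolding R_def using \<Lambda> Q by blast
    show "card (R t) \<le> (n + 1) * 2" for t
    proof -
      have "card (R t) \<le> (\<Sum>l\<in>\<Lambda> t. card (Q t l))" unfolding R_def by (rule card_UN_le) (rule \<Lambda>)
      also have "\<dots> \<le> card (\<Lambda> t) * 2" using sum_bounded_above[of "\<Lambda> t" "\<lambda>l. card (Q t l)" 2] Q(2) by simp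
      also have "\<dots> \<le> (n + 1) * 2" using \<Lambda>(2) by (intro mult_right_mono) auto
      finally show ?thesis .
    qed
    show "finite V" unfolding V_def using fin_T Q by blast
    fix u :: real assume u: "u \<in> {0..1} - V"
    obtain \<theta> l where \<theta>: "\<theta> \<in> {- pi<..pi}"
      and root: "\<forall>\<^sub>F t in nhds \<theta>. kippenhahn_poly A (complex_of_real (l t)) t = 0"
      and line: "z u \<in> support_line \<theta> (l \<theta>)"
      and tang: "((\<lambda>t. Re (cis t * z u) - l t) has_real_derivative 0) (at \<theta>)"
      using E z_in[of u] by (auto simp: kippenhahn_curve_def)
    have line': "Re (cis \<theta> * z u) - l \<theta> = 0" using line by (simp add: support_line_iff)
    \<comment> \<open>No regularity of l is given; continuity at \<theta> is read off from the
      envelope condition.\<close>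
    have cont_l: "isCont l \<theta>"
    proof -
      have "isCont (\<lambda>t. Re (cis t * z u) - l t) \<theta>" using tang by (rule DERIV_isCont)
      moreover have "isCont (\<lambda>t. Re (cis t * z u)) \<theta>"
        unfolding Re_cis_mult by (intro continuous_intros)
      ultimately have "isCont (\<lambda>t. Re (cis t * z u) - (Re (cis t * z u) - l t)) \<theta>"
        by (rule isCont_diff[rotated])
      then show ?thesis by simp
    qed
    have cont_CS: "isCont C \<theta>" "isCont S \<theta>"
      unfolding C_def S_def by (intro continuous_intros)+
    \<comment> \<open>The quadratic expanded around u: its value, slope and leading coefficient
      there. The envelope condition makes the value vanish to first order.\<close>
    let ?q = "\<lambda>t. (1 + u\<^sup>2) * (Re (cis t * z u) - l t)"
    let ?D = "\<lambda>t. - 2 * S t - 2 * (C t + l t) * u" and ?E = "\<lambda>t. - (C t + l t)"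
    have q: "(?q has_real_derivative 0) (at \<theta>)" "?q \<theta> = 0"
      using DERIV_cmult[OF tang, of "1 + u\<^sup>2"] line' by simp_all
    \<comment> \<open>a double root at \<open>u\<close> means tangency, which is excluded by \<open>u \<notin> V\<close>\<close>
    have D0: "?D \<theta> \<noteq> 0"
    proof
      assume D: "?D \<theta> = 0"
      have quad: "(C \<theta> - l \<theta>) + (- 2 * S \<theta>) * u + (- (C \<theta> + l \<theta>)) * u\<^sup>2 = 0"
        using q(2) unfolding z_line .
      have S: "S \<theta> = - (C \<theta> + l \<theta>) * u" using D by (simp add: algebra_simps)
      have d: "C \<theta> - l \<theta> = - ((C \<theta> + l \<theta>) * u\<^sup>2)" using quad unfolding S by (simp add: algebra_simps power2_eq_square)
      have "(C \<theta> + l \<theta>) * (C \<theta> - l \<theta>) = - (S \<theta>)\<^sup>2"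
        unfolding S d by (simp add: power2_eq_square algebra_simps)
      then have l2: "(l \<theta>)\<^sup>2 = b\<^sup>2 + (Re (cis \<theta> * F))\<^sup>2"
        unfolding CS[symmetric] by (simp add: algebra_simps power2_eq_square)
      \<comment> \<open>For odd n this cancels the extra factor l of the Kippenhahn polynomial; it
        rests on b > 0.\<close>
      then have "l \<theta> \<noteq> 0" using pos[of \<theta>] by auto
      moreover have "kippenhahn_poly A (complex_of_real (l \<theta>)) \<theta> = 0"
        using root by (rule eventually_nhds_x_imp_x)
      ultimately have T: "\<theta> \<in> ?T" using \<theta> by (simp add: kippenhahn_poly_recip[OF A] l2)
      have "l \<theta> = h \<theta> \<or> l \<theta> = - h \<theta>"
      proof -
        have "h \<theta> = \<bar>l \<theta>\<bar>" unfolding h_def l2[symmetric] by simp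
        then show ?thesis by (simp add: abs_if)
      qed
      moreover have "u \<in> Q \<theta> (l \<theta>)" using quad by (simp add: Q_def)
      ultimately have "u \<in> Q \<theta> (h \<theta>) \<union> Q \<theta> (- h \<theta>)" by (elim disjE) simp_all
      with T have "u \<in> V" unfolding V_def by (rule UN_I)
      then show False using u by simp
    qed
    have contD: "isCont ?D \<theta>" and contE: "isCont ?E \<theta>"
      using cont_l cont_CS by (auto intro!: continuous_intros)
    obtain d0 where d0: "d0 > 0" "\<And>t. \<bar>t - \<theta>\<bar> < d0 \<Longrightarrow> kippenhahn_poly A (complex_of_real (l t)) t = 0"
      using root by (auto simp: eventually_nhds_metric dist_real_def)
    show "\<exists>\<theta>\<in>{-4..4}. \<forall>e>0. \<exists>d>0. \<forall>t. \<bar>t - \<theta>\<bar> < d \<longrightarrow> (\<exists>v\<in>R t. \<bar>v - u\<bar> \<le> e * \<bar>t - \<theta>\<bar>)"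
    proof (intro bexI[of _ \<theta>] allI impI)
      show "\<theta> \<in> {-4..4}" using \<theta> pi_less_4 by auto
      fix e :: real assume "e > 0"
      then obtain d1 where d1: "d1 > 0" "\<And>t. \<bar>t - \<theta>\<bar> < d1 \<Longrightarrow>
          \<exists>x. \<bar>x\<bar> \<le> e * \<bar>t - \<theta>\<bar> \<and> ?q t + ?D t * x + ?E t * x\<^sup>2 = 0"
        using quadratic_root_little_o[OF q contD D0 contE] by blast
      show "\<exists>d>0. \<forall>t. \<bar>t - \<theta>\<bar> < d \<longrightarrow> (\<exists>v\<in>R t. \<bar>v - u\<bar> \<le> e * \<bar>t - \<theta>\<bar>)"
      proof (intro exI[of _ "min d0 d1"] conjI allI impI)
        show "min d0 d1 > 0" using d0 d1 by simp
        fix t assume t: "\<bar>t - \<theta>\<bar> < min d0 d1"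
        then obtain x where x: "\<bar>x\<bar> \<le> e * \<bar>t - \<theta>\<bar>" "?q t + ?D t * x + ?E t * x\<^sup>2 = 0"
          using d1(2)[of t] by auto
        have "(C t - l t) + (- 2 * S t) * (u + x) + (- (C t + l t)) * (u + x)\<^sup>2 = 0"
          using x(2) unfolding z_line by (simp add: algebra_simps power2_eq_square)
        then have "u + x \<in> R t" using d0(2)[of t] t by (auto simp: R_def \<Lambda>_def Q_def)
        then show "\<exists>v\<in>R t. \<bar>v - u\<bar> \<le> e * \<bar>t - \<theta>\<bar>" using x(1) by (intro bexI[of _ "u + x"]) auto
      qed
    qed
  qed
qed

text \<open>The support function h is itself an eigenvalue branch. For z on the ellipse, Re (cis t
  z) - h t is at most 0 and reaches 0 in the normal direction, so its derivative vanishes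
  there.\<close>

lemma ellipse_subset_kippenhahn_curve:
  assumes A: "A \<in> reciprocal_matrices n" and b: "b > 0"
    and P: "\<And>\<rho>. recip_P n (recip_xi A) \<rho> (b\<^sup>2 + \<rho> * X\<^sup>2) = 0"
  shows "centered_ellipse (of_real X) b \<subseteq> kippenhahn_curve A"
proof
  fix z assume z: "z \<in> centered_ellipse (of_real X) b"
  define x y where "x = Re z" and "y = Im z"
  define a where "a = sqrt (X\<^sup>2 + b\<^sup>2)"
  have a2: "a\<^sup>2 = X\<^sup>2 + b\<^sup>2" by (simp add: a_def)
  have a: "a > 0" using b unfolding a_def by (intro real_sqrt_gt_zero) (simp add: add_nonneg_pos)
  have eq: "x\<^sup>2 / a\<^sup>2 + y\<^sup>2 / b\<^sup>2 = 1"
  proof -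
    define p q where "p = cmod (z - of_real X)" and "q = cmod (z + of_real X)"
    have p2: "p\<^sup>2 = (x - X)\<^sup>2 + y\<^sup>2" and q2: "q\<^sup>2 = (x + X)\<^sup>2 + y\<^sup>2"
      unfolding p_def q_def cmod_power2 by (simp_all add: x_def y_def)
    have pq: "p + q = 2 * a" using z by (simp add: centered_ellipse_def p_def q_def a_def)
    \<comment> \<open>Dividing p^2 - q^2 by p + q = 2 a yields the focal radius p = a - x X / a
      without square roots.\<close>
    have "(p - q) * (2 * a) = p\<^sup>2 - q\<^sup>2" unfolding pq[symmetric] by (simp add: power2_eq_square algebra_simps)
    also have "\<dots> = - 4 * x * X" unfolding p2 q2 by (simp add: power2_eq_square algebra_simps)
    finally have "(p - q) * a * 2 = (- 2 * x * X) * 2" by (simp add: mult_ac)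
    then have "(p - q) * a = - 2 * x * X" unfolding mult_cancel_right by simp
    moreover have "p * a + q * a = 2 * a\<^sup>2" using pq by (simp add: power2_eq_square flip: distrib_right)
    ultimately have pa: "p * a = a\<^sup>2 - x * X" by (simp add: left_diff_distrib)
    have "a\<^sup>2 * ((x - X)\<^sup>2 + y\<^sup>2) = (a\<^sup>2 - x * X)\<^sup>2"
      unfolding p2[symmetric] pa[symmetric] by (simp add: power_mult_distrib)
    then have "a\<^sup>2 * y\<^sup>2 + (a\<^sup>2 - X\<^sup>2) * x\<^sup>2 = a\<^sup>2 * (a\<^sup>2 - X\<^sup>2)"
      by (simp add: power2_eq_square algebra_simps)
    then have "a\<^sup>2 * y\<^sup>2 + b\<^sup>2 * x\<^sup>2 = a\<^sup>2 * b\<^sup>2" by (simp add: a2)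
    then show ?thesis using a b by (simp add: field_simps)
  qed
  define h where "h t = sqrt (b\<^sup>2 + (cos t)\<^sup>2 * X\<^sup>2)" for t
  have pos: "b\<^sup>2 + (cos t)\<^sup>2 * X\<^sup>2 > 0" for t using b by (simp add: add_pos_nonneg)
  have h2: "(h t)\<^sup>2 = b\<^sup>2 + (cos t)\<^sup>2 * X\<^sup>2" for t using pos[of t] by (simp add: h_def)
  have h2': "(h t)\<^sup>2 = (a * cos t)\<^sup>2 + (b * sin t)\<^sup>2" for t
    unfolding h2 power_mult_distrib a2 sin_squared_eq by (simp add: algebra_simps)
  have h_pos: "h t > 0" for t using pos[of t] by (simp add: h_def)
  have Re: "Re (cis t * z) = cos t * x - sin t * y" for t by (simp add: x_def y_def)
  have le: "Re (cis t * z) \<le> h t" for t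
  proof (rule power2_le_imp_le)
    have cs: "(p * r - q * s)\<^sup>2 \<le> (p\<^sup>2 + q\<^sup>2) * (r\<^sup>2 + s\<^sup>2)" for p q r s :: real
    proof -
      have "(p\<^sup>2 + q\<^sup>2) * (r\<^sup>2 + s\<^sup>2) - (p * r - q * s)\<^sup>2 = (p * s + q * r)\<^sup>2"
        by (simp add: power2_eq_square algebra_simps)
      then show ?thesis using zero_le_power2[of "p * s + q * r"] by linarith
    qed
    have "(Re (cis t * z))\<^sup>2 = ((x / a) * (a * cos t) - (y / b) * (b * sin t))\<^sup>2"
      unfolding Re using a b by (simp add: mult.commute)
    also have "\<dots> \<le> ((x / a)\<^sup>2 + (y / b)\<^sup>2) * ((a * cos t)\<^sup>2 + (b * sin t)\<^sup>2)" by (rule cs)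
    also have "\<dots> = (h t)\<^sup>2" unfolding h2' power_divide eq by simp
    finally show "(Re (cis t * z))\<^sup>2 \<le> (h t)\<^sup>2" .
    show "0 \<le> h t" using h_pos[of t] by simp
  qed
  \<comment> \<open>The outer normal (x / a^2, y / b^2) at z, conjugated because the lines are given
    by Re (cis \<theta> z) = l.\<close>
  define w where "w = Complex (x / a\<^sup>2) (- (y / b\<^sup>2))"
  define \<theta> where "\<theta> = Arg w"
  have Re_w: "Re (w * z) = 1" using eq by (simp add: w_def x_def[symmetric] y_def[symmetric] power2_eq_square)
  have w0: "w \<noteq> 0" using Re_w by auto
  have cis: "cis \<theta> = w / of_real (cmod w)" using cis_Arg[OF w0] by (simp add: \<theta>_def sgn_eq)
  have touch: "Re (cis \<theta> * z) = h \<theta>"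
  proof (rule power2_eq_imp_eq)
    have r: "Re (cis \<theta> * z) = 1 / cmod w" using Re_w by (simp add: cis)
    have c: "cos \<theta> = (x / a\<^sup>2) / cmod w" "sin \<theta> = (- (y / b\<^sup>2)) / cmod w"
      using arg_cong[OF cis, of Re] arg_cong[OF cis, of Im] by (simp_all add: w_def)
    have "(h \<theta>)\<^sup>2 = (x\<^sup>2 / a\<^sup>2 + y\<^sup>2 / b\<^sup>2) / (cmod w)\<^sup>2"
      unfolding h2' c using a b by (simp add: power_mult_distrib power_divide add_divide_distrib power2_eq_square mult_ac)
    then show "(Re (cis \<theta> * z))\<^sup>2 = (h \<theta>)\<^sup>2" unfolding r eq by (simp add: power_divide)
    show "0 \<le> Re (cis \<theta> * z)" unfolding r by simp
    show "0 \<le> h \<theta>" using h_pos[of \<theta>] by simp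
  qed
  have "\<theta> \<in> {- pi<..pi}" using Arg_bounded[of w] by (simp add: \<theta>_def)
  moreover have "kippenhahn_poly A (complex_of_real (h t)) t = 0" for t
    unfolding kippenhahn_poly_recip[OF A] h2 using P by simp
  moreover have "z \<in> support_line \<theta> (h \<theta>)" using touch by (simp add: support_line_iff)
  moreover have "((\<lambda>t. Re (cis t * z) - h t) has_real_derivative 0) (at \<theta>)"
  proof -
    obtain D where D: "((\<lambda>t. Re (cis t * z) - h t) has_real_derivative D) (at \<theta>)"
    proof
      show "((\<lambda>t. Re (cis t * z) - h t) has_real_derivative
          (- sin \<theta> * x - cos \<theta> * y) - (2 * cos \<theta> * (- sin \<theta>) * X\<^sup>2) * (inverse (sqrt (b\<^sup>2 + (cos \<theta>)\<^sup>2 * X\<^sup>2)) / 2)) (at \<theta>)"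
        unfolding Re h_def using pos[of \<theta>] by (auto intro!: derivative_eq_intros)
    qed
    moreover have "D = 0"
    proof (rule DERIV_local_max[OF D, of 1])
      have "Re (cis t * z) - h t \<le> Re (cis \<theta> * z) - h \<theta>" for t
        using le[of t] touch by linarith
      then show "\<forall>t. \<bar>\<theta> - t\<bar> < 1 \<longrightarrow> Re (cis t * z) - h t \<le> Re (cis \<theta> * z) - h \<theta>" by blast
    qed simp
    ultimately show ?thesis by simp
  qed
  ultimately show "z \<in> kippenhahn_curve A" unfolding kippenhahn_curve_def
    by (intro CollectI bexI[of _ \<theta>] exI[of _ h]) auto
qed

text \<open>Reality of the foci is part of the conclusion: the leading coefficient in y = cis
  \<theta> is P_n at \<xi> = 0, \<rho> = 1, \<zeta> = F^2, and all complex roots of that polynomial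
  are squares of nodes.\<close>

lemma focus_of_infinite_common_tangents:
  assumes inf: "infinite {\<theta>\<in>{- pi<..pi}. recip_P n \<xi> ((cos \<theta>)\<^sup>2) (c + (Re (cis \<theta> * F))\<^sup>2) = 0}"
    (is "infinite ?T")
  shows "\<exists>k\<in>{1..n div 2}. (F = of_real (chebyshev_node n k) \<or> F = - of_real (chebyshev_node n k)) \<and>
           c = minor_sq n \<xi> (chebyshev_node n k) \<and> recip_system n \<xi> (chebyshev_node n k)"
proof -
  define W where "W \<theta> = recip_P n \<xi> ((cos \<theta>)\<^sup>2) (c + (Re (cis \<theta> * F))\<^sup>2)" for \<theta>
  \<comment> \<open>with \<open>y = cis \<theta>\<close> both \<open>2 y cos \<theta>\<close> and \<open>2 y Re (y F)\<close> are polynomials in \<open>y\<close>\<close>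
  let ?\<Xi> = "\<lambda>i. [:0, 0, 4 * complex_of_real (\<xi> i):]"
  let ?Z = "[:cnj F, 0, F:] ^ 2 + [:0, 0, 4 * complex_of_real c:]"
  define p where "p = recip_P n ?\<Xi> ([:1, 0, 1:] ^ 2) ?Z"
  \<comment> \<open>Scaling all arguments of P_n by 4 y^2 makes them polynomials in y of degree at
    most 4; by homogeneity only the factor (4 y^2)^m appears.\<close>
  have poly_p: "poly p (cis \<theta>) = (4 * (cis \<theta>)\<^sup>2) ^ (n div 2) * of_real (W \<theta>)" for \<theta>
  proof -
    let ?y = "cis \<theta>"
    have y: "?y * cnj ?y = 1" by (simp add: complex_mult_cnj flip: power2_eq_square of_real_power)
    have double: "2 * ?y * of_real (Re v) = ?y * v + ?y * cnj v" for v
    proof -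
      have "of_real (2 * Re v) = v + cnj v" by (simp add: complex_add_cnj)
      then show ?thesis by (metis (no_types, lifting) mult.assoc mult.commute of_real_mult of_real_numeral distrib_left)
    qed
    have e1: "2 * ?y * of_real (cos \<theta>) = ?y\<^sup>2 + 1"
      using double[of ?y] y by (simp add: power2_eq_square)
    have 1: "(?y\<^sup>2 + 1)\<^sup>2 = 4 * ?y\<^sup>2 * of_real ((cos \<theta>)\<^sup>2)"
      unfolding e1[symmetric] by (simp add: power_mult_distrib)
    have "2 * ?y * of_real (Re (?y * F)) = ?y\<^sup>2 * F + (?y * cnj ?y) * cnj F"
      unfolding double by (simp add: power2_eq_square mult_ac)
    then have e: "?y\<^sup>2 * F + cnj F = 2 * ?y * of_real (Re (?y * F))" unfolding y by simp
    have 2: "(?y\<^sup>2 * F + cnj F)\<^sup>2 + 4 * ?y\<^sup>2 * of_real c = 4 * ?y\<^sup>2 * of_real (c + (Re (?y * F))\<^sup>2)"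
      unfolding e by (simp only: power_mult_distrib of_real_add of_real_power distrib_left) simp
    have "poly p ?y = recip_P n (\<lambda>i. (4 * ?y\<^sup>2) * of_real (\<xi> i)) ((?y\<^sup>2 + 1)\<^sup>2)
        ((?y\<^sup>2 * F + cnj F)\<^sup>2 + 4 * ?y\<^sup>2 * of_real c)"
      unfolding p_def poly_recip_P by (simp add: power2_eq_square algebra_simps)
    also have "\<dots> = (4 * ?y\<^sup>2) ^ (n div 2) * of_real (W \<theta>)"
      unfolding 1 2 recip_P_scale W_def of_real_recip_P ..
    finally show ?thesis .
  qed
  have "cis ` ?T \<subseteq> {y. poly p y = 0}" using poly_p by (auto simp: W_def)
  moreover have "infinite (cis ` ?T)"
  proof -
    have "Arg (cis \<theta>) = \<theta>" if "\<theta> \<in> ?T" for \<theta>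
      using that by (intro cis_Arg_unique) auto
    then have "inj_on cis ?T" by (rule inj_on_inverseI)
    then show ?thesis using inf finite_image_iff by blast
  qed
  ultimately have "infinite {y. poly p y = 0}" by (rule infinite_super)
  then have p0: "p = 0" using poly_roots_finite by (rule contrapos_np)
  then have W0: "W \<theta> = 0" for \<theta> using poly_p[of \<theta>] by simp
  have sq: "degree ([:u, 0, v:] ^ 2) \<le> 4 \<and> coeff ([:u, 0, v:] ^ 2) 4 = v\<^sup>2" for u v :: complex
  proof -
    have "degree ([:u, 0, v:] ^ 2) \<le> 2 * 2 \<and> coeff ([:u, 0, v:] ^ 2) (2 * 2) = coeff [:u, 0, v:] 2 ^ 2"
      by (rule coeff_power_top) simp
    moreover have "coeff [:u, 0, v:] 2 = v" "2 * 2 = (4 :: nat)" by (simp_all add: numeral_2_eq_2)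
    ultimately show ?thesis by (simp only:)
  qed
  have "coeff p (4 * (n div 2)) = recip_P n (\<lambda>i. coeff (?\<Xi> i) 4) (coeff ([:1, 0, 1:] ^ 2) 4) (coeff ?Z 4)"
    unfolding p_def
  proof (rule coeff_recip_P_top(2))
    show "degree (?\<Xi> i) \<le> 4" for i by simp
    show "degree ([:1, 0, 1 :: complex:] ^ 2) \<le> 4" using sq by blast
    show "degree ?Z \<le> 4" using sq by (intro degree_add_le) auto
  qed
  also have "(\<lambda>i. coeff (?\<Xi> i) 4) = (\<lambda>_. 0)" by (simp add: numeral_eq_Suc)
  also have "coeff ([:1, 0, 1 :: complex:] ^ 2) 4 = 1" using sq[of 1 1] by simp
  also have "coeff ?Z 4 = F\<^sup>2" unfolding coeff_add using sq[of "cnj F" F] by (simp add: numeral_eq_Suc)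
  finally have "recip_P n (\<lambda>_. 0) 1 (F\<^sup>2) = 0" using p0 by simp
  then obtain k where k: "k \<in> {1..n div 2}" and F2: "F\<^sup>2 = of_real ((chebyshev_node n k)\<^sup>2)"
    using recip_P_0_1_eq_0D by blast
  let ?X = "chebyshev_node n k"
  have F: "F = of_real ?X \<or> F = - of_real ?X" using F2 by (simp add: power2_eq_iff)
  \<comment> \<open>\<open>W\<close> now vanishes for every \<theta>, and cos^2 \<theta> takes every
    value in [0, 1].\<close>
  have "recip_P n \<xi> \<rho> (c + \<rho> * ?X\<^sup>2) = 0" if "\<rho> \<in> {0..1}" for \<rho>
  proof -
    have "(cos (arccos (sqrt \<rho>)))\<^sup>2 = \<rho>" using that by (subst cos_arccos) (auto intro: order.trans[of _ 0])
    moreover have "(Re (cis \<theta> * F))\<^sup>2 = (cos \<theta>)\<^sup>2 * ?X\<^sup>2" for \<theta>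
      using F by (auto simp: power_mult_distrib)
    ultimately show ?thesis using W0[of "arccos (sqrt \<rho>)"] by (simp add: W_def)
  qed
  then have "{0..1} \<subseteq> {\<rho>. recip_P n \<xi> \<rho> (c + \<rho> * ?X\<^sup>2) = 0}" by blast
  moreover have "infinite {0..1 :: real}" by (rule infinite_Icc) simp
  ultimately have "infinite {\<rho>. recip_P n \<xi> \<rho> (c + \<rho> * ?X\<^sup>2) = 0}" using finite_subset by blast
  from recip_system_of_infinite[OF k this] F k show ?thesis by blast
qed

lemma ellipse_subset_kippenhahn_curve_iff:
  assumes A: "A \<in> reciprocal_matrices n" and b: "b > 0"
  shows "centered_ellipse F b \<subseteq> kippenhahn_curve A \<longleftrightarrow>
    (\<exists>k\<in>{1..n div 2}. {F, - F} = {of_real (chebyshev_node n k), - of_real (chebyshev_node n k)} \<and>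
       b\<^sup>2 = minor_sq n (recip_xi A) (chebyshev_node n k) \<and> recip_system n (recip_xi A) (chebyshev_node n k))"
    (is "?lhs \<longleftrightarrow> ?rhs")
proof
  assume ?lhs
  from focus_of_infinite_common_tangents[OF infinite_common_tangents[OF A b this]] show ?rhs by fastforce
next
  assume ?rhs
  then obtain k where k: "k \<in> {1..n div 2}"
    and F: "{F, - F} = {of_real (chebyshev_node n k), - of_real (chebyshev_node n k)}"
    and b2: "b\<^sup>2 = minor_sq n (recip_xi A) (chebyshev_node n k)"
    and sys: "recip_system n (recip_xi A) (chebyshev_node n k)" by blast
  have "centered_ellipse F b = centered_ellipse (of_real (chebyshev_node n k)) b"
    using F by (auto simp: centered_ellipse_def doubleton_eq_iff add.commute)
  then show ?lhs
    using ellipse_subset_kippenhahn_curve[OF A b] recip_system_recip_P[OF k sys] b2 by simp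
qed

text \<open>A line does not determine its angle and distance: (\<theta>, l) and (\<theta> + \<pi>, -
  l) give the same line. Both lead to the same equation, since P_n sees only l^2 and cos^2
  \<theta>.\<close>

lemma contains_degenerate_ellipse_iff:
  assumes A: "A \<in> reciprocal_matrices n" and k: "k \<in> {1..n div 2}"
  shows "contains_degenerate_ellipse A (of_real (chebyshev_node n k)) \<longleftrightarrow>
    minor_sq n (recip_xi A) (chebyshev_node n k) = 0 \<and> recip_system n (recip_xi A) (chebyshev_node n k)"
    (is "?lhs \<longleftrightarrow> ?rhs")
proof
  let ?X = "chebyshev_node n k"
  assume L: ?lhs
  have X: "?X > 0" using k by (rule chebyshev_node_pos)
  \<comment> \<open>Leaving out \<rho> = 0 ensures l \<noteq> 0, so that the factor l of odd n
    cancels.\<close>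
  have "recip_P n (recip_xi A) \<rho> (0 + \<rho> * ?X\<^sup>2) = 0" if \<rho>: "\<rho> \<in> {0<..1}" for \<rho>
  proof -
    define \<theta> where "\<theta> = arccos (sqrt \<rho>)"
    have sq: "0 < sqrt \<rho>" "sqrt \<rho> \<le> 1" using \<rho> by auto
    have cos: "cos \<theta> = sqrt \<rho>" using sq unfolding \<theta>_def by (intro cos_arccos) linarith+
    have bnd: "0 \<le> \<theta>" "\<theta> \<le> pi" 
      using sq arccos_lbound[of "sqrt \<rho>"] arccos_ubound[of "sqrt \<rho>"] unfolding \<theta>_def by linarith+
    then have "\<theta> \<in> {- pi<..pi}" using pi_gt_zero by (auto intro: less_le_trans[of _ 0])
    then have "support_line \<theta> (Re (cis \<theta> * of_real ?X)) \<in> kippenhahn_lines A"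
      using L unfolding contains_degenerate_ellipse_def by blast
    then obtain \<theta>' l where eq: "support_line \<theta> (cos \<theta> * ?X) = support_line \<theta>' l"
      and root: "kippenhahn_poly A (complex_of_real l) \<theta>' = 0"
      by (auto simp: kippenhahn_lines_def)
    have line: "Re (cis \<theta> * z) = cos \<theta> * ?X \<Longrightarrow> Re (cis \<theta>' * z) = l" for z
      using eq unfolding set_eq_iff support_line_iff by blast
    let ?d = "\<theta>' - \<theta>"
    \<comment> \<open>Moving along the line by t keeps its distance l, which forces
      \<open>sin ?d = 0\<close>: the normals agree up to sign.\<close>
    have pt: "cos ?d * (cos \<theta> * ?X) - sin ?d * t = l" for t
    proof -
      let ?z = "cis (- \<theta>) * Complex (cos \<theta> * ?X) t"
      have "cis \<theta> * ?z = Complex (cos \<theta> * ?X) t" by (simp add: cis_mult flip: mult.assoc)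
      then have "Re (cis \<theta> * ?z) = cos \<theta> * ?X" by (simp only: complex.sel)
      then have "Re (cis \<theta>' * ?z) = l" by (rule line)
      moreover have "cis \<theta>' * ?z = cis ?d * Complex (cos \<theta> * ?X) t" by (simp add: cis_mult flip: mult.assoc)
      ultimately show ?thesis by simp
    qed
    have sin: "sin ?d = 0" using pt[of 0] pt[of 1] by simp
    then have cd: "(cos ?d)\<^sup>2 = 1" by (simp add: cos_squared_eq)
    have "l = cos ?d * (cos \<theta> * ?X)" using pt[of 0] by simp
    then have l2: "l\<^sup>2 = \<rho> * ?X\<^sup>2" using \<rho> by (simp add: power_mult_distrib cd cos)
    have "cos \<theta>' = cos ?d * cos \<theta>" using cos_add[of ?d \<theta>] sin by simp
    then have c2: "(cos \<theta>')\<^sup>2 = \<rho>" using \<rho> by (simp add: power_mult_distrib cd cos)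
    have "l\<^sup>2 > 0" using \<rho> X by (simp add: l2)
    then have "l \<noteq> 0" by auto
    then show ?thesis using root by (simp add: kippenhahn_poly_recip[OF A] l2 c2)
  qed
  then have "{0<..1} \<subseteq> {\<rho>. recip_P n (recip_xi A) \<rho> (0 + \<rho> * ?X\<^sup>2) = 0}" by blast
  moreover have "infinite {0<..1 :: real}" by (rule infinite_Ioc) simp
  ultimately have "infinite {\<rho>. recip_P n (recip_xi A) \<rho> (0 + \<rho> * ?X\<^sup>2) = 0}" using finite_subset by blast
  from recip_system_of_infinite[OF k this] show ?rhs by simp
next
  let ?X = "chebyshev_node n k"
  assume R: ?rhs
  have "support_line \<theta> l \<in> kippenhahn_lines A" if "\<theta> \<in> {- pi<..pi}" "l\<^sup>2 = (cos \<theta>)\<^sup>2 * ?X\<^sup>2" for \<theta> l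
  proof -
    have "kippenhahn_poly A (complex_of_real l) \<theta> = 0"
      using recip_system_recip_P[OF k, of "recip_xi A" "(cos \<theta>)\<^sup>2"] R that(2)
      by (simp add: kippenhahn_poly_recip[OF A])
    then show ?thesis using that(1) unfolding kippenhahn_lines_def by blast
  qed
  then show ?lhs unfolding contains_degenerate_ellipse_def by (simp add: power_mult_distrib)
qed

text \<open>The degenerate ellipse appears in the last conjunct because the system only forces C
  \<ge> 0; for C = 0 the second conjunct leaves no ellipse with b > 0 and these foci.\<close>

theorem theorem3:
  fixes A :: "complex mat" and n m :: nat and \<xi> :: "nat \<Rightarrow> real" and X :: "nat \<Rightarrow> real"
  assumes A: "A \<in> reciprocal_matrices n"
    and m: "m = n div 2"
    and xi: "\<xi> = recip_xi A"
    and X: "X = (\<lambda>k. 2 * cos (real k * pi / real (n + 1)))"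
  shows
    "(\<forall>k\<in>{1..m}.
        (\<forall>x C. recip_f n m x C (X k) = 0) \<and>
        (\<exists>a c. a \<noteq> 0 \<and>
           (\<forall>x C. recip_f n (m - 1) x C (X k) = a * C + (\<Sum>i = 1..<n. c i * x i))) \<and>
        (\<exists>c. \<forall>x C. recip_f n (m - 1) x C (X k) = 0 \<longleftrightarrow> C = (\<Sum>i = 1..<n. c i * x i)) \<and>
        (\<forall>x C. recip_f n (m - 1) x C (X k) = 0 \<longleftrightarrow> C = minor_sq n x (X k)) \<and>
        (\<forall>j < m - 1. homogeneous_polynomial {1..<n} (m - j)
           (\<lambda>x. recip_f n j x (minor_sq n x (X k)) (X k))))
     \<and>
     (\<forall>F b. b > 0 \<longrightarrow>
        (centered_ellipse F b \<subseteq> kippenhahn_curve A \<longleftrightarrow>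
         (\<exists>k\<in>{1..m}. {F, - F} = {complex_of_real (X k), - complex_of_real (X k)} \<and>
            b\<^sup>2 = minor_sq n \<xi> (X k) \<and> recip_system n \<xi> (X k))))
     \<and>
     (\<forall>k\<in>{1..m}.
        recip_system n \<xi> (X k) \<longleftrightarrow>
        (\<exists>b>0. centered_ellipse (complex_of_real (X k)) b \<subseteq> kippenhahn_curve A) \<or>
        contains_degenerate_ellipse A (complex_of_real (X k)))"
proof -
  have X': "X = chebyshev_node n" by (simp add: X chebyshev_node_def fun_eq_iff)
  have third: "recip_system n \<xi> (X k) \<longleftrightarrow>
      (\<exists>b>0. centered_ellipse (complex_of_real (X k)) b \<subseteq> kippenhahn_curve A) \<or>
      contains_degenerate_ellipse A (complex_of_real (X k))" if k: "k \<in> {1..n div 2}" for k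
  proof
    assume sys: "recip_system n \<xi> (X k)"
    have "minor_sq n \<xi> (X k) \<ge> 0"
      using minor_sq_nonneg[OF k] sys unfolding X' xi by (simp add: recip_xi_def)
    then consider "minor_sq n \<xi> (X k) = 0" | "minor_sq n \<xi> (X k) > 0" by linarith
    then show "(\<exists>b>0. centered_ellipse (complex_of_real (X k)) b \<subseteq> kippenhahn_curve A) \<or>
      contains_degenerate_ellipse A (complex_of_real (X k))"
    proof cases
      case 1
      then show ?thesis using sys contains_degenerate_ellipse_iff[OF A k] unfolding X' xi by blast
    next
      case 2
      define b where "b = sqrt (minor_sq n \<xi> (X k))"
      have "b > 0" "b\<^sup>2 = minor_sq n \<xi> (X k)" using 2 by (simp_all add: b_def)
      moreover from this have "centered_ellipse (complex_of_real (X k)) b \<subseteq> kippenhahn_curve A"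
        using sys k unfolding X' xi by (subst ellipse_subset_kippenhahn_curve_iff[OF A]) blast+
      ultimately show ?thesis by blast
    qed
  next
    assume "(\<exists>b>0. centered_ellipse (complex_of_real (X k)) b \<subseteq> kippenhahn_curve A) \<or>
      contains_degenerate_ellipse A (complex_of_real (X k))"
    then show "recip_system n \<xi> (X k)"
    proof
      assume "\<exists>b>0. centered_ellipse (complex_of_real (X k)) b \<subseteq> kippenhahn_curve A"
      then obtain b where "b > 0" "centered_ellipse (complex_of_real (X k)) b \<subseteq> kippenhahn_curve A" by blast
      then obtain j where j: "j \<in> {1..n div 2}"
        "{complex_of_real (X k), - complex_of_real (X k)} = {of_real (chebyshev_node n j), - of_real (chebyshev_node n j)}"
        "recip_system n \<xi> (chebyshev_node n j)"
        using ellipse_subset_kippenhahn_curve_iff[OF A] unfolding xi by blast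
      \<comment> \<open>The node j supplied by the ellipse could differ from k; positivity of the
        nodes shows that the pair of foci determines the node.\<close>
      have "X k = chebyshev_node n j \<or> X k = - chebyshev_node n j"
        using j(2) by (auto simp: doubleton_eq_iff simp flip: of_real_minus)
      then have "X k = chebyshev_node n j"
        using chebyshev_node_pos[OF k] chebyshev_node_pos[OF j(1)] unfolding X' by auto
      then show ?thesis using j(3) by simp
    next
      assume "contains_degenerate_ellipse A (complex_of_real (X k))"
      then show ?thesis using contains_degenerate_ellipse_iff[OF A k] unfolding X' xi by blast
    qed
  qed
  show ?thesis
    unfolding m
  proof (intro conjI ballI allI impI)
    fix k assume k: "k \<in> {1..n div 2}"
    show "recip_f n (n div 2) x C (X k) = 0" for x C
      unfolding X' by (rule recip_f_top_node[OF k])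
    show "\<exists>a c. a \<noteq> 0 \<and> (\<forall>x C. recip_f n (n div 2 - 1) x C (X k) = a * C + (\<Sum>i = 1..<n. c i * x i))"
      unfolding X' by (rule recip_f_linear[OF k])
    show "\<exists>c. \<forall>x C. recip_f n (n div 2 - 1) x C (X k) = 0 \<longleftrightarrow> C = (\<Sum>i = 1..<n. c i * x i)"
      unfolding X' by (rule minor_sq_linear[OF k])
    show "recip_f n (n div 2 - 1) x C (X k) = 0 \<longleftrightarrow> C = minor_sq n x (X k)" for x C
      unfolding X' by (rule minor_sq_iff[OF k])
    show "homogeneous_polynomial {1..<n} (n div 2 - j) (\<lambda>x. recip_f n j x (minor_sq n x (X k)) (X k))"
      if "j < n div 2 - 1" for j
      unfolding X' using that by (intro homogeneous_recip_system[OF k]) simp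
    show "recip_system n \<xi> (X k) \<longleftrightarrow>
        (\<exists>b>0. centered_ellipse (complex_of_real (X k)) b \<subseteq> kippenhahn_curve A) \<or>
        contains_degenerate_ellipse A (complex_of_real (X k))" by (rule third[OF k])
  next
    fix F :: complex and b :: real assume "b > 0"
    then show "centered_ellipse F b \<subseteq> kippenhahn_curve A \<longleftrightarrow>
         (\<exists>k\<in>{1..n div 2}. {F, - F} = {complex_of_real (X k), - complex_of_real (X k)} \<and>
            b\<^sup>2 = minor_sq n \<xi> (X k) \<and> recip_system n \<xi> (X k))"
      unfolding X' xi by (rule ellipse_subset_kippenhahn_curve_iff[OF A])
  qed
qed

end
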